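(* Let $\lambda<1$. Then $$\{\gamma\in\mathbb{C}:\ I_\gamma[f]\in\mathcal{S}\text{ for all } f\in\mathcal{K}(\lambda)\}=\left\{\gamma\in\mathbb{C}:\,|\gamma|\le \frac{1}{2(1-\lambda)}\right\}\bigcup \left[\frac{1}{2(1-\lambda)},\frac{3}{2(1-\lambda)}\right].$$
   Context: $\mathbb{D}=\{z\in\mathbb{C}:|z|<1\}$. $\mathcal{A}$ is the class of analytic functions $f$ on $\mathbb{D}$ with $f(0)=0$, $f'(0)=1$; $\mathcal{S}\subset\mathcal{A}$ is the subclass of univalent functions. For $\lambda<1$, $\mathcal{K}(\lambda)=\{f\in\mathcal{A}: f'\neq0 \text{ on }\mathbb{D},\ \mathrm{Re}\,(1+zf''(z)/f'(z))>\lambda \text{ for } z\in\mathbb{D}\}$. For $\gamma\in\mathbb{C}$ and $f\in\mathcal{A}$ with $f'$ nonvanishing on $\mathbb{D}$, the Hornich scalar multiplication is $I_\gamma[f](z)=\int_0^z \{f'(w)\}^\gamma\,dw$, where $\{f'(w)\}^\gamma=\exp(\gamma\log f'(w))$ with the branch chosen so that $\{f'(0)\}^\gamma=1$. For real $a<b$, $[a,b]$ denotes the real segment. *)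

theory Defs
  imports "HOL-Complex_Analysis.Complex_Analysis"
begin

abbreviation unit_disk :: "complex set" where
  "unit_disk \<equiv> ball 0 1"

definition classA :: "(complex \<Rightarrow> complex) \<Rightarrow> bool" where
  "classA f \<longleftrightarrow> f holomorphic_on unit_disk \<and> f 0 = 0 \<and> deriv f 0 = 1"

definition classS :: "(complex \<Rightarrow> complex) \<Rightarrow> bool" where
  "classS f \<longleftrightarrow> classA f \<and> inj_on f unit_disk"

definition classK :: "real \<Rightarrow> (complex \<Rightarrow> complex) \<Rightarrow> bool" where
  "classK lam f \<longleftrightarrow> classA f \<and> (\<forall>z\<in>unit_disk. deriv f z \<noteq> 0) \<and>
     (\<forall>z\<in>unit_disk. Re (1 + z * deriv (deriv f) z / deriv f z) > lam)"

text \<open>The branch of log f' on the disk with value 0 at 0 (unique when f' is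
  nonvanishing on the disk and f'(0)=1).\<close>
definition log_deriv_branch :: "(complex \<Rightarrow> complex) \<Rightarrow> complex \<Rightarrow> complex" where
  "log_deriv_branch f = (SOME L. L holomorphic_on unit_disk \<and> L 0 = 0 \<and>
      (\<forall>z\<in>unit_disk. exp (L z) = deriv f z))"

definition hornich :: "complex \<Rightarrow> (complex \<Rightarrow> complex) \<Rightarrow> complex \<Rightarrow> complex" where
  "hornich \<gamma> f z = contour_integral (linepath 0 z) (\<lambda>w. exp (\<gamma> * log_deriv_branch f w))"

end

theory Submission
  imports Defs
begin

text \<open>
  The transforms satisfy \<open>I\<^sub>\<alpha> \<circ> I\<^sub>\<beta> = I\<^sub>\<alpha>\<^sub>\<beta>\<close>, and for \<open>t > 0\<close> the transform \<open>I\<^sub>t\<close> maps \<open>K(lam)\<close> onto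
  \<open>K(1 - t (1 - lam))\<close>. So it suffices to treat the class \<open>K(0)\<close> of convex functions, for which the claimed set is
  \<open>{\<bar>\<gamma>\<bar> \<le> 1/2} \<union> [1/2, 3/2]\<close>.

  Univalence of \<open>F = I\<^sub>\<gamma>[f]\<close> is proved with chains \<open>F + A(r) H\<close> on the discs \<open>\<bar>w\<bar> \<le> r\<close>, where \<open>A\<close> tends
  to \<open>0\<close> as \<open>r\<close> grows to \<open>1\<close>. The condition on the boundary says that the preimages of a fixed value enter the
  disc faster than its radius shrinks. Hence a collision of two points at the radius \<open>r\<close> survives at smaller
  radii, whereas for small \<open>r\<close> the term \<open>A(r) H\<close> dominates and is injective.

  \<^item> \<open>\<bar>\<gamma>\<bar> \<le> 1/2\<close>, \<open>\<gamma> \<noteq> 1/2\<close>: taking \<open>H(w) = w F'(w)\<close> gives Ahlfors' criterion, which holds because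
    \<open>1 + z f''/f'\<close> has positive real part and therefore lies in an explicit disc.
  \<^item> \<open>\<gamma> \<in> [1/2, 3/2]\<close>: \<open>F'/f' = (f')\<^sup>\<gamma>\<^sup>-\<^sup>1\<close> has positive real part because \<open>\<bar>arg f'\<bar> < \<pi>\<close> for convex \<open>f\<close>, so \<open>F\<close> is
    close-to-convex; take \<open>H(w) = w f'(w)\<close>.

  For all other \<open>\<gamma>\<close> there is \<open>t \<in> (0, 1]\<close> such that \<open>d = 2 t \<gamma>\<close> satisfies \<open>\<bar>d\<bar> > 1\<close> and \<open>\<bar>d - 2\<bar> > 1\<close>. If \<open>k\<close> is
  the half-plane map \<open>z / (1 - z)\<close>, then \<open>I\<^sub>t[k]\<close> is convex, and \<open>I\<^sub>\<gamma>[I\<^sub>t[k]]\<close> is an affine image of \<open>(1 - z)\<^sup>1\<^sup>-\<^sup>d\<close>, which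
  is not injective on the disc.
\<close>

section \<open>Univalence by shrinking chains\<close>

lemma inj_on_if_deriv_near_constant:
  fixes f :: "'a::real_normed_field \<Rightarrow> 'a"
  assumes "convex S"
    and der: "\<And>x. x \<in> S \<Longrightarrow> (f has_field_derivative f' x) (at x within S)"
    and bound: "\<And>x. x \<in> S \<Longrightarrow> norm (f' x - d) \<le> B" and "B < norm d"
  shows "inj_on f S"
proof (rule inj_onI)
  fix x y assume xy: "x \<in> S" "y \<in> S" "f x = f y"
  have "norm ((f x - d * x) - (f y - d * y)) \<le> B * norm (x - y)"
  proof (rule field_differentiable_bound[OF \<open>convex S\<close> _ bound])
    show "((\<lambda>x. f x - d * x) has_field_derivative f' z - d) (at z within S)" if "z \<in> S" for z
      using der[OF that] by (auto intro!: derivative_eq_intros)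
  qed (use xy in auto)
  moreover have "(f x - d * x) - (f y - d * y) = - d * (x - y)"
    using xy by (simp add: algebra_simps)
  ultimately have "norm d * norm (x - y) \<le> B * norm (x - y)"
    by (simp add: norm_mult)
  then show "x = y" using \<open>B < norm d\<close> by (simp add: mult_le_cancel_right)
qed

lemma locally_uniformly_injective:
  fixes \<Phi> :: "'t::t2_space \<Rightarrow> 'a::real_normed_field \<Rightarrow> 'a"
  assumes "open U" "x0 \<in> U"
    and der: "\<And>t x. x \<in> U \<Longrightarrow> (\<Phi> t has_field_derivative \<Phi>' t x) (at x)"
    and cont: "isCont (\<lambda>(t, x). \<Phi>' t x) (t0, x0)" and nz: "\<Phi>' t0 x0 \<noteq> 0"
  obtains T B where "open T" "t0 \<in> T" "open B" "x0 \<in> B" "\<And>t. t \<in> T \<Longrightarrow> inj_on (\<Phi> t) B"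
proof -
  let ?d = "\<Phi>' t0 x0"
  have "\<forall>\<^sub>F p in nhds (t0, x0). dist ((\<lambda>(t, x). \<Phi>' t x) p) ?d < norm ?d / 2"
    using cont nz by (intro tendstoD) (auto simp: isCont_def tendsto_nhds_iff)
  then obtain V where V: "open V" "(t0, x0) \<in> V"
    and near: "\<forall>p\<in>V. dist ((\<lambda>(t, x). \<Phi>' t x) p) ?d < norm ?d / 2"
    unfolding eventually_nhds by (elim exE conjE) (rule that)
  obtain T S where TS: "open T" "open S" "(t0, x0) \<in> T \<times> S" "T \<times> S \<subseteq> V"
    by (rule open_prod_elim[OF V])
  have "open (S \<inter> U)" "x0 \<in> S \<inter> U" using TS \<open>open U\<close> \<open>x0 \<in> U\<close> by auto
  then obtain e where e: "e > 0" "ball x0 e \<subseteq> S \<inter> U" by (rule openE)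
  show ?thesis
  proof (rule that[of T "ball x0 e"])
    show "inj_on (\<Phi> t) (ball x0 e)" if "t \<in> T" for t
    proof (rule inj_on_if_deriv_near_constant[OF convex_ball])
      fix x assume x: "x \<in> ball x0 e"
      show "(\<Phi> t has_field_derivative \<Phi>' t x) (at x within ball x0 e)"
        using x e by (intro has_field_derivative_at_within[OF der]) auto
      have "(t, x) \<in> V" using x e that TS(4) by blast
      from bspec[OF near this] show "norm (\<Phi>' t x - ?d) \<le> norm ?d / 2" by (simp add: dist_norm)
    qed (use nz in simp)
  qed (use TS e in auto)
qed

lemma inj_on_ball_if_inj_on_smaller_balls:
  assumes inj: "\<And>\<rho>. 0 < \<rho> \<Longrightarrow> \<rho> < R \<Longrightarrow> inj_on f (ball a \<rho>)"
  shows "inj_on f (ball a R)"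
proof (rule inj_onI)
  fix x y assume xy: "x \<in> ball a R" "y \<in> ball a R" "f x = f y"
  then have "max (dist a x) (dist a y) < R" by simp
  then obtain \<rho> where \<rho>: "max (dist a x) (dist a y) < \<rho>" "\<rho> < R" using dense by blast
  moreover have "0 < \<rho>" using \<rho>(1) zero_le_dist[of a x] by linarith
  ultimately show "x = y" using inj_onD[OF inj xy(3), of \<rho>] by simp
qed

text \<open>The root is a fixed point, by Brouwer's theorem, of the simplified Newton map.\<close>
lemma root_in_cball_if_nearly_linear:
  fixes G :: "'a::euclidean_space \<Rightarrow> 'b::real_normed_vector"
  assumes "0 < \<rho>" and cont: "continuous_on (cball c \<rho>) G" and g: "bounded_linear g" "inj g"
    and near: "\<And>w. w \<in> cball c \<rho> \<Longrightarrow> norm (g (G w) - (w - c)) \<le> \<rho>"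
  obtains w where "w \<in> cball c \<rho>" "G w = 0"
proof -
  have "continuous_on (cball c \<rho>) (\<lambda>w. w - g (G w))"
    by (intro continuous_intros bounded_linear.continuous_on[OF g(1)] cont)
  moreover have "(\<lambda>w. w - g (G w)) \<in> cball c \<rho> \<rightarrow> cball c \<rho>"
    using near by (auto simp: dist_norm algebra_simps)
  ultimately obtain w where "w \<in> cball c \<rho>" "w - g (G w) = w"
    by (rule brouwer_ball[OF \<open>0 < \<rho>\<close>])
  moreover from this have "g (G w) = g 0" using bounded_linear.linear[OF g(1)] by (simp add: linear_0)
  ultimately show ?thesis using that \<open>inj g\<close> by (blast dest: injD)
qed

lemma eventually_cball_subset_open:
  fixes w v :: "'a::real_normed_vector"
  assumes "open U" "w \<in> U"
  shows "\<forall>\<^sub>F \<epsilon> in at_right 0. cball (w + \<epsilon> *\<^sub>R v) (\<kappa> * \<epsilon>) \<subseteq> U"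
proof -
  obtain e where "e > 0" and e: "ball w e \<subseteq> U" using openE[OF assms] by metis
  have "((\<lambda>\<epsilon>. norm (\<epsilon> *\<^sub>R v) + \<kappa> * \<epsilon>) \<longlongrightarrow> norm (0 *\<^sub>R v) + \<kappa> * 0) (at_right 0)"
    by (intro tendsto_intros)
  then have "\<forall>\<^sub>F \<epsilon> in at_right 0. norm (\<epsilon> *\<^sub>R v) + \<kappa> * \<epsilon> < e"
    by (rule order_tendstoD) (use \<open>e > 0\<close> in simp)
  then show ?thesis
  proof eventually_elim
    case (elim \<epsilon>)
    have "dist w x < e" if "x \<in> cball (w + \<epsilon> *\<^sub>R v) (\<kappa> * \<epsilon>)" for x
      using that elim norm_triangle_ineq[of "x - (w + \<epsilon> *\<^sub>R v)" "\<epsilon> *\<^sub>R v"]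
      by (simp add: dist_norm norm_minus_commute)
    then show ?case using e by auto
  qed
qed

lemma eventually_linearization_error_le:
  fixes \<Phi> :: "'p::real_normed_vector \<times> 'a::real_normed_vector \<Rightarrow> 'b::real_normed_vector"
  assumes der: "(\<Phi> has_derivative \<Phi>') (at (p, w))" and ker: "\<Phi>' (s, v) = 0"
    and g: "bounded_linear g" "\<And>h. g (\<Phi>' (0, h)) = h" and "\<kappa> > 0"
  shows "\<forall>\<^sub>F \<epsilon> in at_right 0. \<forall>x \<in> cball (w + \<epsilon> *\<^sub>R v) (\<kappa> * \<epsilon>).
    norm (g (\<Phi> (p + \<epsilon> *\<^sub>R s, x) - \<Phi> (p, w)) - (x - (w + \<epsilon> *\<^sub>R v))) \<le> \<kappa> * \<epsilon>"
proof -
  interpret g: bounded_linear g by fact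
  interpret \<Phi>': bounded_linear \<Phi>' using der by (rule has_derivative_bounded_linear)
  obtain C where C: "C > 0" "\<And>y. norm (g y) \<le> norm y * C" using g.pos_bounded by blast
  define M where "M = norm s + norm v + \<kappa>"
  have "M > 0" using \<open>\<kappa> > 0\<close> by (auto simp: M_def intro: add_nonneg_pos)
  then have "\<kappa> / (C * M) > 0" using \<open>\<kappa> > 0\<close> \<open>C > 0\<close> by simp
  then obtain d where d: "d > 0" "\<And>q. norm (q - (p, w)) < d \<Longrightarrow>
      norm (\<Phi> q - \<Phi> (p, w) - \<Phi>' (q - (p, w))) \<le> \<kappa> / (C * M) * norm (q - (p, w))"
    using der unfolding has_derivative_at_alt by blast
  have "norm (g (\<Phi> (p + \<epsilon> *\<^sub>R s, x) - \<Phi> (p, w)) - (x - (w + \<epsilon> *\<^sub>R v))) \<le> \<kappa> * \<epsilon>"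
    if \<epsilon>: "0 < \<epsilon>" "\<epsilon> < d / M" and x: "x \<in> cball (w + \<epsilon> *\<^sub>R v) (\<kappa> * \<epsilon>)" for \<epsilon> x
  proof -
    define q where "q = (p + \<epsilon> *\<^sub>R s, x)"
    let ?E = "\<Phi> q - \<Phi> (p, w) - \<Phi>' (q - (p, w))"
    have q: "q - (p, w) = \<epsilon> *\<^sub>R (s, v) + (0, x - (w + \<epsilon> *\<^sub>R v))" by (simp add: q_def)
    have "norm (q - (p, w)) \<le> norm (\<epsilon> *\<^sub>R s) + norm (x - w)"
      using norm_Pair_le[of "\<epsilon> *\<^sub>R s" "x - w"] by (simp add: q_def)
    also have "\<dots> \<le> \<epsilon> * M"
      using x \<epsilon>(1) norm_triangle_ineq[of "x - (w + \<epsilon> *\<^sub>R v)" "\<epsilon> *\<^sub>R v"]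
      by (simp add: M_def dist_norm norm_minus_commute algebra_simps)
    finally have norm_q: "norm (q - (p, w)) \<le> \<epsilon> * M" .
    have "\<epsilon> * M < d" using \<epsilon> \<open>M > 0\<close> by (simp add: field_simps)
    have "\<Phi>' (q - (p, w)) = \<Phi>' (0, x - (w + \<epsilon> *\<^sub>R v))"
      unfolding q \<Phi>'.add \<Phi>'.scaleR ker by simp
    then have "g ?E = g (\<Phi> q - \<Phi> (p, w)) - (x - (w + \<epsilon> *\<^sub>R v))"
      by (simp only: g.diff g(2))
    then have "norm (g (\<Phi> q - \<Phi> (p, w)) - (x - (w + \<epsilon> *\<^sub>R v))) \<le> norm ?E * C"
      using C(2)[of ?E] by (simp only:)
    also have "\<dots> \<le> (\<kappa> / (C * M) * norm (q - (p, w))) * C"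
      using norm_q \<open>\<epsilon> * M < d\<close> C(1) by (intro mult_right_mono d(2)) auto
    also have "\<dots> \<le> (\<kappa> / (C * M) * (\<epsilon> * M)) * C"
      using norm_q C(1) \<open>M > 0\<close> \<open>\<kappa> > 0\<close> by (intro mult_right_mono mult_left_mono) auto
    also have "\<dots> = \<kappa> * \<epsilon>" using C(1) \<open>M > 0\<close> by simp
    finally show ?thesis by (simp only: q_def)
  qed
  moreover have "d / M > 0" using d \<open>M > 0\<close> by simp
  ultimately show ?thesis unfolding eventually_at_right_field by blast
qed

lemma level_set_near_kernel_direction:
  fixes \<Phi> :: "'p::real_normed_vector \<times> 'a::euclidean_space \<Rightarrow> 'b::real_normed_vector"
  assumes U: "open U" "w \<in> U" and cont: "\<And>p. continuous_on U (\<lambda>w. \<Phi> (p, w))"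
    and der: "(\<Phi> has_derivative \<Phi>') (at (p, w))" and ker: "\<Phi>' (s, v) = 0"
    and g: "bounded_linear g" "inj g" "\<And>h. g (\<Phi>' (0, h)) = h" and "\<kappa> > 0"
  shows "\<forall>\<^sub>F \<epsilon> in at_right 0. \<exists>x \<in> cball (w + \<epsilon> *\<^sub>R v) (\<kappa> * \<epsilon>). \<Phi> (p + \<epsilon> *\<^sub>R s, x) = \<Phi> (p, w)"
  using eventually_linearization_error_le[OF der ker g(1,3) \<open>\<kappa> > 0\<close>]
    eventually_cball_subset_open[OF U, of v \<kappa>] eventually_at_right_less[of 0]
proof eventually_elim
  case (elim \<epsilon>)
  obtain x where "x \<in> cball (w + \<epsilon> *\<^sub>R v) (\<kappa> * \<epsilon>)" "\<Phi> (p + \<epsilon> *\<^sub>R s, x) - \<Phi> (p, w) = 0"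
  proof (rule root_in_cball_if_nearly_linear[OF _ _ g(1,2)])
    show "continuous_on (cball (w + \<epsilon> *\<^sub>R v) (\<kappa> * \<epsilon>)) (\<lambda>x. \<Phi> (p + \<epsilon> *\<^sub>R s, x) - \<Phi> (p, w))"
      by (intro continuous_intros continuous_on_subset[OF cont elim(2)])
    show "0 < \<kappa> * \<epsilon>" using \<open>\<kappa> > 0\<close> elim(3) by simp
  qed (use elim(1) in blast)+
  then show ?case by auto
qed

lemma eventually_norm_decreases:
  fixes w v :: "'a::real_inner"
  assumes "w \<noteq> 0" "inner w v < - norm w"
  obtains \<kappa> where "\<kappa> > 0" "\<forall>\<^sub>F \<epsilon> in at_right 0. norm (w + \<epsilon> *\<^sub>R v) + (1 + \<kappa>) * \<epsilon> \<le> norm w"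
proof -
  define \<kappa> where "\<kappa> = (- inner v (sgn w) - 1) / 2"
  have "inner v (sgn w) < - 1"
    using assms by (simp add: sgn_div_norm inner_commute field_simps)
  then have "\<kappa> > 0" and neg: "inner v (sgn w) + (1 + \<kappa>) < 0" by (simp_all add: \<kappa>_def field_simps)
  have "((\<lambda>\<epsilon>. norm (w + \<epsilon> *\<^sub>R v)) has_real_derivative inner v (sgn w)) (at 0)"
    unfolding has_field_derivative_def
    by (rule has_derivative_eq_rhs[OF has_derivative_compose[OF _ has_derivative_norm]])
       (auto intro!: derivative_eq_intros simp: \<open>w \<noteq> 0\<close> fun_eq_iff)
  then have "((\<lambda>\<epsilon>. norm (w + \<epsilon> *\<^sub>R v) + (1 + \<kappa>) * \<epsilon>) has_real_derivative inner v (sgn w) + (1 + \<kappa>)) (at 0)"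
    by (auto intro!: derivative_eq_intros)
  with neg obtain d where "d > 0" "\<forall>\<epsilon>>0. \<epsilon> < d \<longrightarrow> norm (w + \<epsilon> *\<^sub>R v) + (1 + \<kappa>) * \<epsilon> < norm w"
    by (auto dest!: DERIV_neg_dec_right)
  then have "\<forall>\<^sub>F \<epsilon> in at_right 0. norm (w + \<epsilon> *\<^sub>R v) + (1 + \<kappa>) * \<epsilon> \<le> norm w"
    unfolding eventually_at_right_field using less_imp_le by blast
  with \<open>\<kappa> > 0\<close> show ?thesis by (rule that)
qed

lemma eventually_cball_inside_shrinking_cball:
  fixes w v :: "'a::real_inner"
  assumes r: "0 < r" "norm w \<le> r" and inward: "norm w = r \<Longrightarrow> inner w v < - r"
  obtains \<kappa> where "\<kappa> > 0" "\<forall>\<^sub>F \<epsilon> in at_right 0. cball (w + \<epsilon> *\<^sub>R v) (\<kappa> * \<epsilon>) \<subseteq> cball 0 (r - \<epsilon>)"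
proof -
  obtain \<kappa> where "\<kappa> > 0"
    and \<kappa>: "\<forall>\<^sub>F \<epsilon> in at_right 0. norm (w + \<epsilon> *\<^sub>R v) + (1 + \<kappa>) * \<epsilon> \<le> r"
  proof (cases "norm w = r")
    case True
    then have "w \<noteq> 0" "inner w v < - norm w" using r inward by auto
    from eventually_norm_decreases[OF this] show ?thesis using that True by metis
  next
    case False
    have "((\<lambda>\<epsilon>. norm (w + \<epsilon> *\<^sub>R v) + (1 + 1) * \<epsilon>) \<longlongrightarrow> norm (w + 0 *\<^sub>R v) + (1 + 1) * 0) (at_right 0)"
      by (intro tendsto_intros)
    then have "\<forall>\<^sub>F \<epsilon> in at_right 0. norm (w + \<epsilon> *\<^sub>R v) + (1 + 1) * \<epsilon> < r"
      by (rule order_tendstoD) (use False r in simp)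
    then have "\<forall>\<^sub>F \<epsilon> in at_right 0. norm (w + \<epsilon> *\<^sub>R v) + (1 + 1) * \<epsilon> \<le> r"
      by eventually_elim simp
    then show ?thesis using that[of 1] by simp
  qed
  from \<kappa> have "\<forall>\<^sub>F \<epsilon> in at_right 0. cball (w + \<epsilon> *\<^sub>R v) (\<kappa> * \<epsilon>) \<subseteq> cball 0 (r - \<epsilon>)"
  proof eventually_elim
    case (elim \<epsilon>)
    have "norm x \<le> r - \<epsilon>" if "x \<in> cball (w + \<epsilon> *\<^sub>R v) (\<kappa> * \<epsilon>)" for x
      using that elim norm_triangle_ineq[of "x - (w + \<epsilon> *\<^sub>R v)" "w + \<epsilon> *\<^sub>R v"]
      by (simp add: dist_norm norm_minus_commute algebra_simps)
    then show ?case by auto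
  qed
  with \<open>\<kappa> > 0\<close> show ?thesis by (rule that)
qed

lemma uniform_limit_add_vanishing_multiple:
  fixes a :: "'n \<Rightarrow> 'b::real_normed_algebra" and f h :: "'a \<Rightarrow> 'b"
  assumes "(a \<longlongrightarrow> 0) G" "bounded (h ` K)"
  shows "uniform_limit K (\<lambda>n x. f x + a n * h x) f G"
proof -
  have "uniform_limit K (\<lambda>n _. a n) (\<lambda>_. 0) G"
    using assms(1) by (auto simp: uniform_limit_iff tendsto_iff elim: eventually_mono)
  then have "uniform_limit K (\<lambda>n x. a n * h x) (\<lambda>x. 0 * h x) G"
    using assms(2) by (intro uniform_lim_mult uniform_limit_const) (auto simp: bounded_iff)
  from uniform_limit_add[OF uniform_limit_const[where c = f] this] show ?thesis by simp
qed

lemma sequence_at_left: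
  fixes a b :: real
  assumes "a < b"
  obtains x :: "nat \<Rightarrow> real" where "\<And>n. a \<le> x n" "\<And>n. x n < b" "filterlim x (at_left b) sequentially"
proof -
  define x where "x n = b - (b - a) * inverse (real (Suc n))" for n
  have "a \<le> x n" for n
  proof -
    have "(b - a) * inverse (real (Suc n)) \<le> (b - a) * 1"
      using assms by (intro mult_left_mono) (auto simp: field_simps)
    then show ?thesis by (simp add: x_def)
  qed
  moreover have less: "x n < b" for n using assms by (simp add: x_def)
  moreover have "x \<longlonglongrightarrow> b - (b - a) * 0"
    unfolding x_def by (intro tendsto_intros LIMSEQ_inverse_real_of_nat)
  then have "filterlim x (at_left b) sequentially"
    using less by (auto simp: filterlim_at less_imp_neq)
  ultimately show ?thesis by (rule that)
qed

lemma isCont_pencil: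
  fixes a :: "'t::t2_space \<Rightarrow> 'b::real_normed_algebra" and f h :: "'a::t2_space \<Rightarrow> 'b"
  assumes "isCont a t" "isCont f w" "isCont h w"
  shows "isCont (\<lambda>(t, w). f w + a t * h w) (t, w)"
proof -
  have "isCont fst (t, w)" "isCont snd (t, w)" by (simp_all add: continuous_fst continuous_snd)
  then have "isCont (\<lambda>q. a (fst q)) (t, w)" "isCont (\<lambda>q. f (snd q)) (t, w)" "isCont (\<lambda>q. h (snd q)) (t, w)"
    using assms by (auto intro: isCont_o2[of _ fst a] isCont_o2[of _ snd f] isCont_o2[of _ snd h])
  then show ?thesis unfolding case_prod_unfold by (intro continuous_add continuous_mult)
qed

locale shrinking_chain =
  fixes F H :: "complex \<Rightarrow> complex" and A A' :: "real \<Rightarrow> complex" and R :: real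
  assumes holomorphic: "F holomorphic_on ball 0 R" "H holomorphic_on ball 0 R"
    and A_deriv: "\<And>r. 0 < r \<Longrightarrow> r < R \<Longrightarrow> (A has_vector_derivative A' r) (at r)"
    and nonzero: "\<And>r w. 0 < r \<Longrightarrow> r < R \<Longrightarrow> norm w \<le> r \<Longrightarrow> deriv F w + A r * deriv H w \<noteq> 0"
    and inward: "\<And>r w. 0 < r \<Longrightarrow> r < R \<Longrightarrow> norm w = r \<Longrightarrow>
      Re (- of_real r * A' r * H w / (w * (deriv F w + A r * deriv H w))) > 1"
begin

definition chain :: "real \<Rightarrow> complex \<Rightarrow> complex" where
  "chain r w = F w + A r * H w"

definition chain_deriv :: "real \<Rightarrow> complex \<Rightarrow> complex" where
  "chain_deriv r w = deriv F w + A r * deriv H w"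

lemma F_H_has_field_derivative:
  assumes "w \<in> ball 0 R"
  shows "(F has_field_derivative deriv F w) (at w)" "(H has_field_derivative deriv H w) (at w)"
  using holomorphic_derivI[OF holomorphic(1) open_ball assms]
    holomorphic_derivI[OF holomorphic(2) open_ball assms] by simp_all

lemma chain_has_field_derivative:
  "w \<in> ball 0 R \<Longrightarrow> (chain r has_field_derivative chain_deriv r w) (at w)"
  unfolding chain_def chain_deriv_def by (intro DERIV_add DERIV_cmult F_H_has_field_derivative)

lemma isCont_A: "0 < r \<Longrightarrow> r < R \<Longrightarrow> isCont A r"
  using A_deriv by (rule has_vector_derivative_continuous)

lemma isCont_deriv:
  assumes "w \<in> ball 0 R"
  shows "isCont (deriv F) w" "isCont (deriv H) w"
  using holomorphic assms
  by (auto intro!: continuous_on_interior[of "ball 0 R"] holomorphic_on_imp_continuous_on holomorphic_deriv)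

lemma isCont_chain:
  "0 < r \<Longrightarrow> r < R \<Longrightarrow> w \<in> ball 0 R \<Longrightarrow> isCont (\<lambda>(r, w). chain r w) (r, w)"
  unfolding chain_def using F_H_has_field_derivative
  by (intro isCont_pencil isCont_A) (auto intro: DERIV_isCont)

lemma isCont_chain_deriv:
  "0 < r \<Longrightarrow> r < R \<Longrightarrow> w \<in> ball 0 R \<Longrightarrow> isCont (\<lambda>(r, w). chain_deriv r w) (r, w)"
  unfolding chain_deriv_def by (intro isCont_pencil isCont_A isCont_deriv)

lemma eventually_inj_on_chain_small:
  assumes "0 < R" and A: "filterlim A at_infinity (at_right 0)" and "deriv H 0 \<noteq> 0"
  shows "\<forall>\<^sub>F r in at_right 0. inj_on (chain r) (cball 0 r)"
proof -
  obtain T B where TB: "open T" "0 \<in> T" "open B" "0 \<in> B"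
    and inj: "\<And>t. t \<in> T \<Longrightarrow> inj_on (\<lambda>w. H w + t * F w) B"
  proof (rule locally_uniformly_injective[of "ball 0 R" 0 "\<lambda>t w. H w + t * F w"
        "\<lambda>t w. deriv H w + t * deriv F w" 0])
    show "((\<lambda>w. H w + t * F w) has_field_derivative deriv H w + t * deriv F w) (at w)"
      if "w \<in> ball 0 R" for t w
      by (intro DERIV_add DERIV_cmult F_H_has_field_derivative that)
    show "isCont (\<lambda>(t, w). deriv H w + t * deriv F w) (0, 0)"
      using \<open>0 < R\<close> by (intro isCont_pencil isCont_deriv continuous_ident) auto
  qed (use assms in auto)
  obtain e where e: "e > 0" "cball 0 e \<subseteq> B" using TB open_contains_cball by blast
  have "((\<lambda>r. inverse (A r)) \<longlongrightarrow> 0) (at_right 0)"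
    by (rule filterlim_compose[OF tendsto_inverse_0 A])
  then have "\<forall>\<^sub>F r in at_right 0. inverse (A r) \<in> T"
    using TB(1,2) by (rule topological_tendstoD)
  moreover have "\<forall>\<^sub>F r in at_right 0. A r \<noteq> 0" using A by (rule filterlim_at_infinity_imp_eventually_ne)
  moreover have "\<forall>\<^sub>F r in at_right 0. r < e" using order_tendstoD(2)[OF tendsto_ident_at e(1)] .
  ultimately show ?thesis
  proof eventually_elim
    case (elim r)
    have "chain r w = A r * (H w + inverse (A r) * F w)" for w
      using elim(2) by (simp add: chain_def field_simps)
    moreover have "inj_on (\<lambda>w. H w + inverse (A r) * F w) (cball 0 r)"
      using inj[OF elim(1)] e(2) elim(3) by (rule_tac inj_on_subset) auto
    ultimately show ?case using elim(2) by (simp add: inj_on_def)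
  qed
qed

lemma not_inj_on_chain_iff:
  "\<not> inj_on (chain s) (cball 0 s) \<longleftrightarrow>
    (\<exists>z z'. norm z \<le> s \<and> norm z' \<le> s \<and> z \<noteq> z' \<and> chain s z = chain s z')"
  by (metis inj_on_def mem_cball_0)

lemma isCont_chain_difference:
  assumes "0 < fst q" "fst q < R" "fst (snd q) \<in> ball 0 R" "snd (snd q) \<in> ball 0 R"
  shows "isCont (\<lambda>(s, z, z'). chain s z - chain s z') q"
proof -
  have "isCont (\<lambda>q. (fst q, fst (snd q))) q" "isCont (\<lambda>q. (fst q, snd (snd q))) q"
    by (intro continuous_intros)+
  from isCont_o2[OF this(1) isCont_chain[OF assms(1,2,3)]] isCont_o2[OF this(2) isCont_chain[OF assms(1,2,4)]]
  show ?thesis by (simp add: case_prod_unfold continuous_diff)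
qed

definition collisions :: "real \<Rightarrow> real \<Rightarrow> (real \<times> complex \<times> complex) set" where
  "collisions \<rho> r = {(s, z, z'). \<rho> \<le> s \<and> s \<le> r \<and> norm z \<le> s \<and> norm z' \<le> s \<and> z \<noteq> z' \<and> chain s z = chain s z'}"

text \<open>Local injectivity keeps collisions away from the diagonal.\<close>
lemma compact_collisions:
  assumes "0 < \<rho>" "r < R"
  shows "compact (collisions \<rho> r)"
proof -
  define E :: "(real \<times> complex \<times> complex) set"
    where "E = {(s, z, z'). \<rho> \<le> s \<and> s \<le> r \<and> norm z \<le> s \<and> norm z' \<le> s}"
  define V where "V = \<Union> {T \<times> B \<times> B | T B. open T \<and> open B \<and> (\<forall>s\<in>T. inj_on (chain s) B)}"
  have "closed E"
    unfolding E_def case_prod_unfold by (intro closed_Collect_conj closed_Collect_le continuous_intros)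
  moreover have "E \<subseteq> {\<rho>..r} \<times> cball 0 r \<times> cball 0 r" by (auto simp: E_def)
  then have "bounded E"
    by (rule bounded_subset[rotated]) (intro bounded_Times bounded_closed_interval bounded_cball)
  ultimately have "compact E" by (simp add: compact_eq_bounded_closed)
  have "continuous_on E (\<lambda>(s, z, z'). chain s z - chain s z')"
    using assms by (intro continuous_at_imp_continuous_on ballI isCont_chain_difference) (auto simp: E_def)
  from continuous_closed_preimage_constant[OF this \<open>closed E\<close>, of 0]
  have compact: "compact (E \<inter> {q \<in> E. (\<lambda>(s, z, z'). chain s z - chain s z') q = 0})"
    using \<open>compact E\<close> by (intro compact_Int_closed)
  have "open V" unfolding V_def by (intro open_Union) (auto intro!: open_Times)
  have "collisions \<rho> r = E \<inter> {q \<in> E. (\<lambda>(s, z, z'). chain s z - chain s z') q = 0} - V"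
  proof -
    have "(s, z, z) \<in> V" if "(s, z, z) \<in> E" for s z
    proof -
      have s: "0 < s" "s < R" "norm z \<le> s" "z \<in> ball 0 R" using that assms by (auto simp: E_def)
      then obtain T B where "open T" "s \<in> T" "open B" "z \<in> B" "\<And>t. t \<in> T \<Longrightarrow> inj_on (chain t) B"
        using locally_uniformly_injective[OF open_ball s(4) chain_has_field_derivative
            isCont_chain_deriv] nonzero[OF s(1-3)] unfolding chain_deriv_def by metis
      then show ?thesis by (auto simp: V_def)
    qed
    moreover have "z = z'" if "(s, z, z') \<in> V" "chain s z = chain s z'" for s z z'
      using that by (auto simp: V_def dest: inj_onD)
    ultimately show ?thesis by (auto simp: collisions_def E_def)
  qed
  then show ?thesis using compact_diff[OF compact \<open>open V\<close>] by (simp only:)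
qed

lemma chain_has_derivative:
  assumes "0 < r" "r < R" "w \<in> ball 0 R"
  shows "((\<lambda>(r, w). chain r w) has_derivative 
    (\<lambda>(s, h). chain_deriv r w * h + of_real s * A' r * H w)) (at (r, w))"
proof -
  let ?q = "(r, w)"
  have F: "(F has_derivative (*) (deriv F w)) (at (snd ?q))"
    and H: "(H has_derivative (*) (deriv H w)) (at (snd ?q))"
    and A: "(A has_derivative (\<lambda>s. s *\<^sub>R A' r)) (at (fst ?q))"
    using F_H_has_field_derivative[OF assms(3)] A_deriv[OF assms(1,2)]
    by (simp_all add: has_field_derivative_def has_vector_derivative_def)
  have "((\<lambda>q. F (snd q) + A (fst q) * H (snd q)) has_derivative
      (\<lambda>q. deriv F w * snd q + (A (fst ?q) * (deriv H w * snd q) + (fst q *\<^sub>R A' r) * H (snd ?q)))) (at ?q)"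
    by (intro has_derivative_add has_derivative_mult
        has_derivative_compose[OF has_derivative_snd[OF has_derivative_ident] F]
        has_derivative_compose[OF has_derivative_snd[OF has_derivative_ident] H]
        has_derivative_compose[OF has_derivative_fst[OF has_derivative_ident] A])
  then show ?thesis
    by (simp add: chain_def chain_deriv_def case_prod_unfold scaleR_conv_of_real algebra_simps)
qed

text \<open>The velocity of a solution of \<open>chain r w = const\<close> as \<open>r\<close> decreases.\<close>
definition velocity :: "real \<Rightarrow> complex \<Rightarrow> complex" where
  "velocity r w = A' r * H w / chain_deriv r w"

lemma inner_velocity_less:
  assumes r: "0 < r" "r < R" "norm w = r"
  shows "inner w (velocity r w) < - r"
proof -
  have "- of_real r * A' r * H w / (w * chain_deriv r w) = (- r) *\<^sub>R (velocity r w / w)"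
    by (simp add: velocity_def scaleR_conv_of_real mult_ac)
  then have "1 < - r * Re (velocity r w / w)"
    using inward[OF r] unfolding chain_deriv_def by (simp only: scaleR_complex.sel)
  moreover have "inner w (velocity r w) = r\<^sup>2 * Re (velocity r w / w)"
    using r by (simp add: inner_complex_def Re_divide flip: cmod_power2)
  moreover have "r * (r * Re (velocity r w / w)) < r * (- 1)"
    using r calculation(1) by (intro mult_strict_left_mono) auto
  ultimately show ?thesis by (simp add: power2_eq_square)
qed

lemma chain_level_set_near_velocity:
  assumes r: "0 < r" "r < R" "norm z \<le> r" and "\<kappa> > 0"
  shows "\<forall>\<^sub>F \<epsilon> in at_right 0. \<exists>w \<in> cball (z + \<epsilon> *\<^sub>R velocity r z) (\<kappa> * \<epsilon>). chain (r - \<epsilon>) w = chain r z"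
proof -
  let ?D = "chain_deriv r z" and ?L = "\<lambda>(s, h). chain_deriv r z * h + of_real s * A' r * H z"
  have D: "?D \<noteq> 0" using nonzero[OF r] by (simp add: chain_deriv_def)
  have z: "z \<in> ball 0 R" using r by simp
  have "\<forall>\<^sub>F \<epsilon> in at_right 0. \<exists>w \<in> cball (z + \<epsilon> *\<^sub>R velocity r z) (\<kappa> * \<epsilon>).
      (\<lambda>(r, w). chain r w) (r + \<epsilon> *\<^sub>R (- 1), w) = (\<lambda>(r, w). chain r w) (r, z)"
  proof (rule level_set_near_kernel_direction[OF open_ball z _ chain_has_derivative[OF r(1,2) z]])
    show "continuous_on (ball 0 R) (\<lambda>w. (\<lambda>(r, w). chain r w) (p, w))" for p
      unfolding case_prod_conv using chain_has_field_derivative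
      by (meson DERIV_isCont continuous_at_imp_continuous_on)
    show "?L (- 1, velocity r z) = 0" using D by (simp add: velocity_def)
    show "bounded_linear (\<lambda>y. y / ?D)" by (rule bounded_linear_divide)
    show "inj (\<lambda>y. y / ?D)" using D by (simp add: inj_def)
    show "?L (0, h) / ?D = h" for h using D by simp
  qed fact
  then show ?thesis by simp
qed

lemma chain_level_set_moves_inward:
  assumes r: "0 < r" "r < R" "norm z \<le> r" and "\<delta> > 0"
  shows "\<forall>\<^sub>F \<epsilon> in at_right 0. \<exists>w \<in> ball z \<delta>. norm w \<le> r - \<epsilon> \<and> chain (r - \<epsilon>) w = chain r z"
proof -
  define v where "v = velocity r z"
  have "inner z v < - r" if "norm z = r" using inner_velocity_less[OF r(1,2) that] by (simp add: v_def)
  then obtain \<kappa> where "\<kappa> > 0"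
    and inside: "\<forall>\<^sub>F \<epsilon> in at_right 0. cball (z + \<epsilon> *\<^sub>R v) (\<kappa> * \<epsilon>) \<subseteq> cball 0 (r - \<epsilon>)"
    by (rule eventually_cball_inside_shrinking_cball[OF r(1,3)])
  note level = chain_level_set_near_velocity[OF r \<open>\<kappa> > 0\<close>, folded v_def]
  have "z \<in> ball z \<delta>" using \<open>\<delta> > 0\<close> by simp
  note near = eventually_cball_subset_open[OF open_ball this, of v \<kappa>]
  from level inside near show ?thesis
  proof eventually_elim
    case (elim \<epsilon>)
    then obtain w where "w \<in> cball (z + \<epsilon> *\<^sub>R v) (\<kappa> * \<epsilon>)" "chain (r - \<epsilon>) w = chain r z" by blast
    moreover from this have "w \<in> ball z \<delta>" "w \<in> cball 0 (r - \<epsilon>)" using elim(2,3) by blast+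
    ultimately show ?case by auto
  qed
qed

lemma collision_persists:
  assumes r: "0 < r" "r < R" and "\<not> inj_on (chain r) (cball 0 r)"
  shows "\<forall>\<^sub>F \<epsilon> in at_right 0. \<not> inj_on (chain (r - \<epsilon>)) (cball 0 (r - \<epsilon>))"
proof -
  obtain z z' where z: "norm z \<le> r" "norm z' \<le> r" "z \<noteq> z'" "chain r z = chain r z'"
    using assms(3) unfolding not_inj_on_chain_iff by blast
  then have "dist z z' / 2 > 0" by simp
  from chain_level_set_moves_inward[OF r z(1) this] chain_level_set_moves_inward[OF r z(2) this]
  show ?thesis
  proof eventually_elim
    case (elim \<epsilon>)
    then obtain w w' where w: "dist z w < dist z z' / 2" "norm w \<le> r - \<epsilon>" "chain (r - \<epsilon>) w = chain r z"
      "dist z' w' < dist z z' / 2" "norm w' \<le> r - \<epsilon>" "chain (r - \<epsilon>) w' = chain r z'"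
      by auto
    then have "w \<noteq> w'" using dist_triangle_half_l[of z w "dist z z'" z'] by (auto simp: dist_commute)
    then show ?case unfolding not_inj_on_chain_iff using w z(4) by metis
  qed
qed

lemma inj_on_chain:
  assumes A: "filterlim A at_infinity (at_right 0)" and "deriv H 0 \<noteq> 0" and r: "0 < r" "r < R"
  shows "inj_on (chain r) (cball 0 r)"
proof (rule ccontr)
  assume bad: "\<not> inj_on (chain r) (cball 0 r)"
  have "0 < R" using r by simp
  from eventually_inj_on_chain_small[OF this A \<open>deriv H 0 \<noteq> 0\<close>]
  obtain \<rho> where "\<rho> > 0" and small: "\<And>s. 0 < s \<Longrightarrow> s < \<rho> \<Longrightarrow> inj_on (chain s) (cball 0 s)"
    unfolding eventually_at_right_field by auto
  have collision: "\<exists>q \<in> collisions \<rho> r. fst q = s"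
    if s: "\<not> inj_on (chain s) (cball 0 s)" "0 < s" "s \<le> r" for s
  proof -
    have "\<rho> \<le> s" using small[of s] s by force
    moreover obtain z z' where "norm z \<le> s" "norm z' \<le> s" "z \<noteq> z'" "chain s z = chain s z'"
      using s(1) unfolding not_inj_on_chain_iff by blast
    ultimately show ?thesis using s by (intro bexI[of _ "(s, z, z')"]) (auto simp: collisions_def)
  qed
  have "collisions \<rho> r \<noteq> {}" using collision[OF bad r(1)] by auto
  then obtain s z z' where least: "(s, z, z') \<in> collisions \<rho> r" "\<And>q. q \<in> collisions \<rho> r \<Longrightarrow> s \<le> fst q"
    using continuous_attains_inf[OF compact_collisions[OF \<open>\<rho> > 0\<close> r(2)], of fst]
    by (force intro: continuous_intros)
  then have s: "0 < s" "s \<le> r" "s < R" "\<not> inj_on (chain s) (cball 0 s)"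
    using \<open>\<rho> > 0\<close> r(2) unfolding not_inj_on_chain_iff by (auto simp: collisions_def)
  have "\<forall>\<^sub>F \<epsilon> in at_right 0. 0 < \<epsilon> \<and> \<epsilon> < s"
    using \<open>0 < s\<close> unfolding eventually_at_right_field by blast
  with collision_persists[OF s(1,3,4)] have "\<forall>\<^sub>F \<epsilon> in at_right (0::real). False"
  proof eventually_elim
    case (elim \<epsilon>)
    then obtain q where "q \<in> collisions \<rho> r" "fst q = s - \<epsilon>" using collision[of "s - \<epsilon>"] s(2) by auto
    then show False using least(2)[of q] elim(2) by simp
  qed
  then show False by simp
qed

theorem inj_on_ball:
  assumes A: "filterlim A at_infinity (at_right 0)" "(A \<longlongrightarrow> 0) (at_left R)"
    and "deriv F 0 \<noteq> 0" "deriv H 0 \<noteq> 0"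
  shows "inj_on F (ball 0 R)"
proof (rule inj_on_ball_if_inj_on_smaller_balls)
  fix \<rho> assume \<rho>: "0 < \<rho>" "\<rho> < R"
  then have sub: "ball (0::complex) \<rho> \<subseteq> ball 0 R" by (simp add: subset_ball)
  obtain r :: "nat \<Rightarrow> real" where r: "\<And>n. \<rho> \<le> r n" "\<And>n. r n < R" "filterlim r (at_left R) sequentially"
    using sequence_at_left[OF \<rho>(2)] by metis
  have A_r: "(\<lambda>n. A (r n)) \<longlonglongrightarrow> 0" using A(2) r(3) by (rule filterlim_compose)
  show "inj_on F (ball 0 \<rho>)"
  proof (rule Hurwitz_injective[OF open_ball connected_ball])
    show "chain (r n) holomorphic_on ball 0 \<rho>" for n
      unfolding chain_def by (intro holomorphic_intros holomorphic[THEN holomorphic_on_subset, OF sub])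
    show "F holomorphic_on ball 0 \<rho>" using holomorphic(1) sub by (rule holomorphic_on_subset)
    show "inj_on (chain (r n)) (ball 0 \<rho>)" for n
    proof (rule inj_on_subset)
      show "inj_on (chain (r n)) (cball 0 (r n))"
        by (rule inj_on_chain[OF A(1) \<open>deriv H 0 \<noteq> 0\<close>]) (use r(1,2)[of n] \<rho> in linarith)+
      show "ball 0 \<rho> \<subseteq> cball (0::complex) (r n)"
        using r(1)[of n] by (simp add: ball_subset_cball_iff)
    qed
    show "\<not> F constant_on ball 0 \<rho>"
      by (rule nonzero_deriv_nonconstant[OF F_H_has_field_derivative(1) open_ball _ \<open>deriv F 0 \<noteq> 0\<close>])
        (use \<rho> in auto)
    fix K :: "complex set" assume "compact K" "K \<subseteq> ball 0 \<rho>"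
    then have "bounded (H ` K)"
      using sub by (intro compact_imp_bounded compact_continuous_image holomorphic_on_imp_continuous_on
          holomorphic_on_subset[OF holomorphic(2)]) auto
    then show "uniform_limit K (\<lambda>n. chain (r n)) F sequentially"
      unfolding chain_def[abs_def] by (rule uniform_limit_add_vanishing_multiple[OF A_r])
  qed
qed

end

section \<open>Criteria for univalence\<close>

definition pre_Schwarzian :: "(complex \<Rightarrow> complex) \<Rightarrow> complex \<Rightarrow> complex" where
  "pre_Schwarzian f z = deriv (deriv f) z / deriv f z"

lemma has_field_derivative_ident_times_deriv:
  assumes "f holomorphic_on S" "open S" "z \<in> S" "deriv f z \<noteq> 0"
  shows "((\<lambda>w. w * deriv f w) has_field_derivative deriv f z * (1 + z * pre_Schwarzian f z)) (at z)"
  using DERIV_mult[OF DERIV_ident holomorphic_derivI[OF holomorphic_deriv[OF assms(1,2)] assms(2,3)]] assms(4)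
  by (simp add: pre_Schwarzian_def algebra_simps)

lemma has_real_derivative_power_divide:
  fixes r R :: real
  assumes "r \<noteq> 0"
  shows "((\<lambda>r. (R / r) ^ N) has_real_derivative - (real N * (R / r) ^ N / r)) (at r)"
proof (cases N)
  case (Suc n)
  have "((\<lambda>r. R / r) has_real_derivative - (R / r) / r) (at r)"
    using assms by (auto intro!: derivative_eq_intros)
  from DERIV_power[OF this, of N] show ?thesis
    by (rule DERIV_cong) (simp add: Suc)
qed simp

lemma filterlim_power_divide_at_right_0:
  assumes "0 < R" "0 < N"
  shows "filterlim (\<lambda>r::real. (R / r) ^ N) at_top (at_right 0)"
  unfolding divide_inverse using assms
  by (intro filterlim_pow_at_top filterlim_tendsto_pos_mult_at_top[OF tendsto_const]
      filterlim_inverse_at_top_right)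

lemma filterlim_power_divide_diff_1_at_infinity:
  fixes k :: "'a::real_normed_field"
  assumes "k \<noteq> 0" "0 < R" "0 < N"
  shows "filterlim (\<lambda>r. k * of_real ((R / r) ^ N - 1)) at_infinity (at_right 0)"
proof (rule filterlim_norm_at_top_imp_at_infinity)
  have "filterlim (\<lambda>r. - 1 + (R / r) ^ N) at_top (at_right 0)"
    using assms by (intro filterlim_tendsto_add_at_top[OF tendsto_const] filterlim_power_divide_at_right_0)
  then show "filterlim (\<lambda>r. norm (k * of_real ((R / r) ^ N - 1))) at_top (at_right 0)"
    unfolding norm_mult norm_of_real using \<open>k \<noteq> 0\<close>
    by (intro filterlim_tendsto_pos_mult_at_top[OF tendsto_const] filterlim_compose[OF filterlim_abs_real])
      simp_all
qed

text \<open>The variable \<open>x\<close> stands for \<open>(R / r) ^ N\<close>.\<close>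
lemma inj_on_ball_by_power_chain:
  fixes F H :: "complex \<Rightarrow> complex" and N :: nat and R :: real
  assumes "F holomorphic_on ball 0 R" "H holomorphic_on ball 0 R" "deriv F 0 \<noteq> 0" "deriv H 0 \<noteq> 0"
    and "k \<noteq> 0" "N > 0" "R > 0"
    and nonzero: "\<And>x w. 1 < x \<Longrightarrow> norm w < R \<Longrightarrow> norm w ^ N * x \<le> R ^ N \<Longrightarrow>
      deriv F w + k * of_real (x - 1) * deriv H w \<noteq> 0"
    and inward: "\<And>x w. 1 < x \<Longrightarrow> norm w < R \<Longrightarrow> w \<noteq> 0 \<Longrightarrow> norm w ^ N * x = R ^ N \<Longrightarrow>
      Re (of_nat N * k * of_real x * H w / (w * (deriv F w + k * of_real (x - 1) * deriv H w))) > 1"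
  shows "inj_on F (ball 0 R)"
proof -
  define A where "A r = k * of_real ((R / r) ^ N - 1)" for r
  define A' where "A' r = k * of_real (- (real N * (R / r) ^ N / r))" for r
  have x: "1 < (R / r) ^ N" "norm w < R" "norm w ^ N * (R / r) ^ N \<le> R ^ N"
    if "0 < r" "r < R" "norm w \<le> r" for r and w :: complex
  proof -
    show "1 < (R / r) ^ N" using that \<open>N > 0\<close> by (intro one_less_power) auto
    have "norm w ^ N * (R / r) ^ N \<le> r ^ N * (R / r) ^ N"
      using that by (intro mult_right_mono power_mono) auto
    then show "norm w ^ N * (R / r) ^ N \<le> R ^ N" using that by (simp add: power_divide)
  qed (use that in simp)
  have "shrinking_chain F H A A' R"
  proof
    show "(A has_vector_derivative A' r) (at r)" if "0 < r" "r < R" for r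
    proof -
      have "((\<lambda>r. (R / r) ^ N - 1) has_real_derivative - (real N * (R / r) ^ N / r)) (at r)"
        using DERIV_diff[OF has_real_derivative_power_divide[of r R N] DERIV_const] that by simp
      then show ?thesis
        unfolding A_def A'_def by (intro has_vector_derivative_mult_right has_vector_derivative_of_real)
    qed
    show "deriv F w + A r * deriv H w \<noteq> 0" if "0 < r" "r < R" "norm w \<le> r" for r w
      using nonzero[OF x[OF that]] by (simp add: A_def)
    show "Re (- of_real r * A' r * H w / (w * (deriv F w + A r * deriv H w))) > 1"
      if r: "0 < r" "r < R" "norm w = r" for r w
    proof -
      have "norm w \<le> r" "norm w ^ N * (R / r) ^ N = R ^ N" "w \<noteq> 0" using r by (auto simp: power_divide)
      moreover have "- of_real r * A' r = of_nat N * k * of_real ((R / r) ^ N)"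
        using r by (simp add: A'_def)
      ultimately show ?thesis using inward[OF x(1,2)[OF r(1,2)]] unfolding A_def by simp
    qed
  qed fact+
  moreover have "filterlim A at_infinity (at_right 0)"
    unfolding A_def[abs_def] by (rule filterlim_power_divide_diff_1_at_infinity) fact+
  moreover have "(A \<longlongrightarrow> 0) (at_left R)"
  proof -
    have "(A \<longlongrightarrow> k * of_real ((R / R) ^ N - 1)) (at_left R)"
      unfolding A_def using \<open>R > 0\<close> by (intro tendsto_intros) auto
    then show ?thesis using \<open>R > 0\<close> by simp
  qed
  ultimately show ?thesis using assms(3,4) by (rule shrinking_chain.inj_on_ball)
qed

lemma inj_on_ball_by_ident_times_deriv_chain:
  fixes f F :: "complex \<Rightarrow> complex" and N :: nat and R :: real
  defines "p \<equiv> \<lambda>w. 1 + w * pre_Schwarzian f w" and "e \<equiv> \<lambda>w. deriv F w / deriv f w"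
  assumes hol: "f holomorphic_on ball 0 R" "F holomorphic_on ball 0 R"
    and nz: "\<And>w. w \<in> ball 0 R \<Longrightarrow> deriv f w \<noteq> 0" "deriv F 0 \<noteq> 0"
    and "k \<noteq> 0" "N > 0" "R > 0"
    and nonzero: "\<And>x w. 1 < x \<Longrightarrow> norm w < R \<Longrightarrow> norm w ^ N * x \<le> R ^ N \<Longrightarrow>
      e w + k * of_real (x - 1) * p w \<noteq> 0"
    and inward: "\<And>x w. 1 < x \<Longrightarrow> norm w < R \<Longrightarrow> norm w ^ N * x = R ^ N \<Longrightarrow>
      Re (of_nat N * k * of_real x / (e w + k * of_real (x - 1) * p w)) > 1"
  shows "inj_on F (ball 0 R)"
proof -
  have deriv_H: "deriv (\<lambda>w. w * deriv f w) w = deriv f w * p w" if "w \<in> ball 0 R" for w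
    using has_field_derivative_ident_times_deriv[OF hol(1) open_ball that nz(1)[OF that]]
    unfolding p_def by (rule DERIV_imp_deriv)
  have factored: "deriv F w + k * of_real (x - 1) * deriv (\<lambda>w. w * deriv f w) w =
      deriv f w * (e w + k * of_real (x - 1) * p w)" if "norm w < R" for x w
    using deriv_H[of w] nz(1)[of w] that by (simp add: e_def field_simps)
  show ?thesis
  proof (rule inj_on_ball_by_power_chain[where H = "\<lambda>w. w * deriv f w"])
    show "(\<lambda>w. w * deriv f w) holomorphic_on ball 0 R"
      using hol(1) by (intro holomorphic_intros holomorphic_deriv) auto
    show "deriv (\<lambda>w. w * deriv f w) 0 \<noteq> 0" using deriv_H[of 0] nz(1)[of 0] \<open>R > 0\<close> by (simp add: p_def)
    show "deriv F w + k * of_real (x - 1) * deriv (\<lambda>w. w * deriv f w) w \<noteq> 0"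
      if "1 < x" "norm w < R" "norm w ^ N * x \<le> R ^ N" for x w
      unfolding factored[OF that(2)] using nonzero[OF that] nz(1)[of w] that(2) by simp
    show "Re (of_nat N * k * of_real x * (w * deriv f w) /
        (w * (deriv F w + k * of_real (x - 1) * deriv (\<lambda>w. w * deriv f w) w))) > 1"
      if "1 < x" "norm w < R" "w \<noteq> 0" "norm w ^ N * x = R ^ N" for x w
    proof -
      have "of_nat N * k * of_real x * (w * deriv f w) /
            (w * (deriv f w * (e w + k * of_real (x - 1) * p w))) =
          of_nat N * k * of_real x / (e w + k * of_real (x - 1) * p w)"
        using nz(1)[of w] that by simp
      then show ?thesis unfolding factored[OF that(2)] using inward[OF that(1,2,4)] by (simp only:)
    qed
  qed fact+
qed

lemma Re_two_divide_one_plus_gt_1: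
  assumes "norm y < 1"
  shows "Re (2 / (1 + y)) > 1"
proof -
  have "(norm y)\<^sup>2 < 1" using assms by (simp add: abs_square_less_1)
  then have "(Re y)\<^sup>2 + (Im y)\<^sup>2 < 1" by (simp add: cmod_power2)
  moreover have "1 + Re y > 0" using assms abs_Re_le_cmod[of y] by linarith
  moreover have "(1 + Re y)\<^sup>2 + (Im y)\<^sup>2 > 0" using calculation(2) by (simp add: add_pos_nonneg)
  ultimately show ?thesis
    by (simp add: Re_divide pos_less_divide_eq) (simp add: power2_eq_square algebra_simps)
qed

lemma Ahlfors_denominator:
  fixes c Q :: complex and q x :: real
  defines "Y \<equiv> c * of_real q + of_real (1 - q) * Q" and "E \<equiv> 1 + c + of_real (x - 1) * (1 + Q)"
  assumes "norm c \<le> 1" "norm Y < 1" "q < 1" "1 < x"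
  shows "q * x \<le> 1 \<Longrightarrow> E \<noteq> 0" and "q * x = 1 \<Longrightarrow> E = of_real x * (1 + Y)"
proof -
  have E: "of_real (1 - q) * E = of_real (1 - q * x) * (1 + c) + of_real (x - 1) * (1 + Y)"
    by (simp add: E_def Y_def algebra_simps)
  show "E \<noteq> 0" if "q * x \<le> 1"
  proof -
    have "Re (of_real (1 - q) * E) = (1 - q * x) * Re (1 + c) + (x - 1) * Re (1 + Y)"
      unfolding E by simp
    moreover have "(1 - q * x) * Re (1 + c) \<ge> 0" using that assms abs_Re_le_cmod[of c] by simp
    moreover have "(x - 1) * Re (1 + Y) > 0"
      using assms abs_Re_le_cmod[of Y] by (intro mult_pos_pos) auto
    ultimately show ?thesis by auto
  qed
  show "E = of_real x * (1 + Y)" if "q * x = 1"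
  proof -
    have "of_real (x - 1) = of_real x * complex_of_real (1 - q)"
      using that by (simp add: algebra_simps flip: of_real_mult)
    then have "of_real (1 - q) * E = of_real (1 - q) * (of_real x * (1 + Y))" unfolding E using that by simp
    moreover have "complex_of_real (1 - q) \<noteq> 0" unfolding of_real_eq_0_iff using assms by simp
    ultimately show ?thesis by (metis mult_left_cancel)
  qed
qed

theorem Ahlfors_univalence_criterion:
  assumes hol: "F holomorphic_on ball 0 1" and nz: "\<And>w. w \<in> ball 0 1 \<Longrightarrow> deriv F w \<noteq> 0"
    and c: "norm c \<le> 1" "c \<noteq> -1"
    and bound: "\<And>w. w \<in> ball 0 1 \<Longrightarrow>
      norm (c * of_real ((norm w)\<^sup>2) + of_real (1 - (norm w)\<^sup>2) * (w * pre_Schwarzian F w)) < 1"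
  shows "inj_on F (ball 0 1)"
proof -
  define E where "E x w = 1 + c + of_real (x - 1) * (1 + w * pre_Schwarzian F w)" for x w
  have c_nonzero: "1 + c \<noteq> 0" using c(2) by (metis add.inverse_unique)
  have denominator_eq: "deriv F w / deriv F w + 1 / (1 + c) * of_real (x - 1) * (1 + w * pre_Schwarzian F w) =
      E x w / (1 + c)"
    if "norm w < 1" for x w
    using nz[of w] that c_nonzero by (simp add: E_def field_simps)
  show ?thesis
  proof (rule inj_on_ball_by_ident_times_deriv_chain[where f = F and k = "1 / (1 + c)" and N = 2])
    fix x :: real and w :: complex assume x: "1 < x" and w: "norm w < 1"
    have "(norm w)\<^sup>2 < 1" using w by (simp add: abs_square_less_1)
    note denominator = Ahlfors_denominator[OF c(1) bound this x, folded E_def]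
    show "deriv F w / deriv F w + 1 / (1 + c) * of_real (x - 1) * (1 + w * pre_Schwarzian F w) \<noteq> 0"
      if "(norm w)\<^sup>2 * x \<le> 1\<^sup>2"
      unfolding denominator_eq[OF w] using denominator(1) that w c_nonzero by simp
    show "Re (of_nat 2 * (1 / (1 + c)) * of_real x /
        (deriv F w / deriv F w + 1 / (1 + c) * of_real (x - 1) * (1 + w * pre_Schwarzian F w))) > 1"
      if "(norm w)\<^sup>2 * x = 1\<^sup>2"
    proof -
      define Y where "Y = c * of_real ((norm w)\<^sup>2) + of_real (1 - (norm w)\<^sup>2) * (w * pre_Schwarzian F w)"
      have "norm Y < 1" using bound[of w] w by (simp add: Y_def)
      have "E x w = of_real x * (1 + Y)" using denominator(2) that w by (simp add: Y_def)
      then have "of_nat 2 * (1 / (1 + c)) * of_real x / (E x w / (1 + c)) = 2 / (1 + Y)"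
        using x c_nonzero by simp
      then show ?thesis unfolding denominator_eq[OF w] using Re_two_divide_one_plus_gt_1[OF \<open>norm Y < 1\<close>] by simp
    qed
  qed (use hol nz c_nonzero in auto)
qed

lemma Re_divide_gt_1:
  assumes "0 < x" "\<delta> * x \<le> Re d" "norm d \<le> M * x" "M\<^sup>2 < n * \<delta>" "0 \<le> n" "d \<noteq> 0"
  shows "Re (of_real (n * x) / d) > 1"
proof -
  have "(norm d)\<^sup>2 \<le> (M * x)\<^sup>2" using assms(3) by (rule power_mono) simp
  also have "\<dots> = M\<^sup>2 * x\<^sup>2" by (rule power_mult_distrib)
  also have "\<dots> < (n * \<delta>) * x\<^sup>2" using assms by (intro mult_strict_right_mono) auto
  also have "\<dots> = (n * x) * (\<delta> * x)" by (simp add: power2_eq_square)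
  also have "\<dots> \<le> (n * x) * Re d" using assms by (intro mult_left_mono) auto
  finally have "(norm d)\<^sup>2 < n * x * Re d" .
  moreover have "Re (of_real (n * x) / d) = n * x * Re d / (norm d)\<^sup>2"
    by (simp add: Re_divide cmod_power2)
  ultimately show ?thesis using \<open>d \<noteq> 0\<close> by (simp add: pos_less_divide_eq)
qed

lemma compact_Re_pos_bounds:
  fixes g :: "'a::topological_space \<Rightarrow> complex"
  assumes "compact S" and cont: "continuous_on S g" and pos: "\<And>z. z \<in> S \<Longrightarrow> Re (g z) > 0"
  obtains \<delta> M where "\<delta> > 0" "\<And>z. z \<in> S \<Longrightarrow> \<delta> \<le> Re (g z)" "\<And>z. z \<in> S \<Longrightarrow> norm (g z) \<le> M"
proof (cases "S = {}")
  case True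
  then show ?thesis using that[of 1] by simp
next
  case False
  have "continuous_on S (\<lambda>z. Re (g z))" by (intro continuous_intros cont)
  then obtain a where "a \<in> S" "\<forall>z\<in>S. Re (g a) \<le> Re (g z)"
    using continuous_attains_inf[OF \<open>compact S\<close> False] by blast
  moreover obtain M where "\<And>z. z \<in> S \<Longrightarrow> norm (g z) \<le> M"
    using compact_imp_bounded[OF compact_continuous_image[OF cont \<open>compact S\<close>]] by (auto simp: bounded_iff)
  ultimately show ?thesis using that[of "Re (g a)" M] pos by simp
qed

lemma Re_pos_combination_exponent:
  fixes p e :: "'a::topological_space \<Rightarrow> complex"
  assumes "compact S" and cont: "continuous_on S p" "continuous_on S e"
    and pos: "\<And>z. z \<in> S \<Longrightarrow> Re (p z) > 0" "\<And>z. z \<in> S \<Longrightarrow> Re (e z) > 0"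
  obtains n :: nat where "n > 0"
    and "\<And>x z. 1 < x \<Longrightarrow> z \<in> S \<Longrightarrow> e z + of_real (x - 1) * p z \<noteq> 0"
    and "\<And>x z. 1 < x \<Longrightarrow> z \<in> S \<Longrightarrow> Re (of_real (real n * x) / (e z + of_real (x - 1) * p z)) > 1"
proof -
  define d where "d x z = e z + of_real (x - 1) * p z" for x z
  obtain \<delta>\<^sub>p M\<^sub>p where p: "\<delta>\<^sub>p > 0" "\<And>z. z \<in> S \<Longrightarrow> \<delta>\<^sub>p \<le> Re (p z)" "\<And>z. z \<in> S \<Longrightarrow> norm (p z) \<le> M\<^sub>p"
    using compact_Re_pos_bounds[OF \<open>compact S\<close> cont(1) pos(1)] by blast
  obtain \<delta>\<^sub>e M\<^sub>e where e: "\<delta>\<^sub>e > 0" "\<And>z. z \<in> S \<Longrightarrow> \<delta>\<^sub>e \<le> Re (e z)" "\<And>z. z \<in> S \<Longrightarrow> norm (e z) \<le> M\<^sub>e"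
    using compact_Re_pos_bounds[OF \<open>compact S\<close> cont(2) pos(2)] by blast
  define \<delta> M where "\<delta> = min \<delta>\<^sub>p \<delta>\<^sub>e" and "M = max M\<^sub>p M\<^sub>e"
  have \<delta>: "\<delta> > 0" "\<And>z. z \<in> S \<Longrightarrow> \<delta> \<le> Re (p z)" "\<And>z. z \<in> S \<Longrightarrow> \<delta> \<le> Re (e z)"
    using p(1,2) e(1,2) by (auto simp: \<delta>_def min_le_iff_disj)
  have M: "\<And>z. z \<in> S \<Longrightarrow> norm (p z) \<le> M" "\<And>z. z \<in> S \<Longrightarrow> norm (e z) \<le> M"
    using p(3) e(3) by (auto simp: M_def le_max_iff_disj)
  have Re_d: "\<delta> * x \<le> Re (d x z)" and norm_d: "norm (d x z) \<le> M * x" if "1 < x" "z \<in> S" for x z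
  proof -
    have "(x - 1) * \<delta> \<le> (x - 1) * Re (p z)" "(x - 1) * norm (p z) \<le> (x - 1) * M"
      using that \<delta>(2) M(1) by (auto intro!: mult_left_mono)
    moreover have "norm (d x z) \<le> norm (e z) + (x - 1) * norm (p z)"
      unfolding d_def using that
      by (intro order_trans[OF norm_triangle_ineq]) (simp add: norm_mult del: of_real_diff)
    ultimately show "\<delta> * x \<le> Re (d x z)" "norm (d x z) \<le> M * x"
      using \<delta>(3)[OF that(2)] M(2)[OF that(2)] by (simp_all add: d_def algebra_simps)
  qed
  have d_nz: "d x z \<noteq> 0" if "1 < x" "z \<in> S" for x z
  proof -
    have "0 < \<delta> * x" using \<delta>(1) that by simp
    then show ?thesis using Re_d[OF that] by auto
  qed
  obtain n :: nat where "M\<^sup>2 / \<delta> < real n" using reals_Archimedean2 by blast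
  then have "M\<^sup>2 < real (Suc n) * \<delta>" using \<delta>(1) by (simp add: field_simps)
  then have "Re (of_real (real (Suc n) * x) / d x z) > 1" if "1 < x" "z \<in> S" for x z
    using that Re_d norm_d d_nz by (intro Re_divide_gt_1[of x \<delta> _ M]) auto
  then show ?thesis using that[of "Suc n"] d_nz unfolding d_def by blast
qed

text \<open>On the disc of radius \<open>R < 1\<close> a large exponent \<open>N\<close> makes the level sets move as fast as necessary.\<close>
theorem close_to_convex_imp_inj_on:
  assumes hol: "f holomorphic_on ball 0 1" "F holomorphic_on ball 0 1"
    and nz: "\<And>z. z \<in> ball 0 1 \<Longrightarrow> deriv f z \<noteq> 0"
    and convex: "\<And>z. z \<in> ball 0 1 \<Longrightarrow> Re (1 + z * pre_Schwarzian f z) > 0"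
    and close: "\<And>z. z \<in> ball 0 1 \<Longrightarrow> Re (deriv F z / deriv f z) > 0"
  shows "inj_on F (ball 0 1)"
proof (rule inj_on_ball_if_inj_on_smaller_balls)
  fix R :: real assume R: "0 < R" "R < 1"
  define p where "p z = 1 + z * pre_Schwarzian f z" for z
  define e where "e z = deriv F z / deriv f z" for z
  have sub: "cball 0 R \<subseteq> ball (0::complex) 1" "ball 0 R \<subseteq> ball (0::complex) 1"
    using R by (simp_all add: cball_subset_ball_iff subset_ball)
  have "p holomorphic_on ball 0 1" "e holomorphic_on ball 0 1"
    unfolding p_def[abs_def] e_def[abs_def] pre_Schwarzian_def using hol nz
    by (auto intro!: holomorphic_intros holomorphic_deriv)
  then have "continuous_on (cball 0 R) p" "continuous_on (cball 0 R) e"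
    using sub(1) by (auto intro: holomorphic_on_imp_continuous_on holomorphic_on_subset)
  moreover have "Re (p z) > 0" "Re (e z) > 0" if "z \<in> cball 0 R" for z
    using convex close that sub by (auto simp: p_def e_def)
  ultimately obtain N :: nat where "N > 0"
    and nonzero: "\<And>x w. 1 < x \<Longrightarrow> w \<in> cball 0 R \<Longrightarrow> e w + of_real (x - 1) * p w \<noteq> 0"
    and inward: "\<And>x w. 1 < x \<Longrightarrow> w \<in> cball 0 R \<Longrightarrow> Re (of_real (real N * x) / (e w + of_real (x - 1) * p w)) > 1"
    using Re_pos_combination_exponent[OF compact_cball] by blast
  show "inj_on F (ball 0 R)"
  proof (rule inj_on_ball_by_ident_times_deriv_chain[where f = f and k = 1 and N = N])
    show "f holomorphic_on ball 0 R" "F holomorphic_on ball 0 R"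
      using hol sub(2) by (auto intro: holomorphic_on_subset)
    show "deriv f w \<noteq> 0" if "w \<in> ball 0 R" for w using nz sub(2) that by blast
    show "deriv F 0 \<noteq> 0" using close[of 0] by auto
    fix x :: real and w :: complex assume "1 < x" "norm w < R"
    then show "deriv F w / deriv f w + 1 * of_real (x - 1) * (1 + w * pre_Schwarzian f w) \<noteq> 0"
      and "Re (of_nat N * 1 * of_real x /
        (deriv F w / deriv f w + 1 * of_real (x - 1) * (1 + w * pre_Schwarzian f w))) > 1"
      using nonzero[of x w] inward[of x w] by (simp_all add: p_def e_def)
  qed (use R \<open>N > 0\<close> in auto)
qed

section \<open>Convex functions\<close>

lemma Schwarz_Lemma_cball:
  assumes hol: "f holomorphic_on ball 0 R" and cont: "continuous_on (cball 0 R) f" and "f 0 = 0"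
    and bound: "\<And>z. z \<in> ball 0 R \<Longrightarrow> norm (f z) \<le> M" and "0 < R" "0 < M" and z: "z \<in> cball 0 R"
  shows "norm (f z) \<le> M * norm z / R"
proof -
  have interior: "norm (f z) \<le> M * norm z / R" if z: "z \<in> ball 0 R" for z
  proof (rule field_le_mult_one_interval)
    fix s :: real assume s: "0 < s" "s < 1"
    define g where "g \<zeta> = of_real (s / M) * f (of_real R * \<zeta>)" for \<zeta>
    have scale: "of_real R * \<zeta> \<in> ball 0 R" if "norm \<zeta> < 1" for \<zeta> :: complex
      using that \<open>0 < R\<close> by (simp add: norm_mult)
    have "norm (g (z / of_real R)) \<le> norm (z / of_real R)"
    proof (rule Schwarz_Lemma(1)[where f = g])
      show "g holomorphic_on ball 0 1"
        unfolding g_def[abs_def] using scale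
        by (intro holomorphic_intros holomorphic_on_compose_gen[OF _ hol, unfolded o_def]) auto
      show "norm (g \<zeta>) < 1" if "norm \<zeta> < 1" for \<zeta>
      proof -
        have "s * norm (f (of_real R * \<zeta>)) \<le> s * M"
          using bound[OF scale[OF that]] s by (intro mult_left_mono) auto
        also have "\<dots> < 1 * M" using s \<open>0 < M\<close> by (intro mult_strict_right_mono) auto
        finally show ?thesis using s \<open>0 < M\<close> by (simp add: g_def norm_mult norm_divide)
      qed
    qed (use z \<open>0 < R\<close> \<open>f 0 = 0\<close> in \<open>auto simp: g_def norm_divide\<close>)
    then show "s * norm (f z) \<le> M * norm z / R"
      using s \<open>0 < R\<close> \<open>0 < M\<close> by (simp add: g_def norm_mult norm_divide field_simps)
  qed
  have "norm (f z) - M * norm z / R \<le> 0"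
  proof (rule continuous_le_on_closure[where S = "ball 0 R" and f = "\<lambda>z. norm (f z) - M * norm z / R"])
    show "continuous_on (closure (ball 0 R)) (\<lambda>z. norm (f z) - M * norm z / R)"
      using cont \<open>0 < R\<close> by (auto intro!: continuous_intros)
  qed (use z interior \<open>0 < R\<close> in auto)
  then show ?thesis by simp
qed

lemma deriv_nonneg_if_min_at_right:
  fixes g :: "real \<Rightarrow> real"
  assumes "(g has_real_derivative D) (at a)" and "\<And>s. a < s \<Longrightarrow> g a \<le> g s"
  shows "0 \<le> D"
proof (rule ccontr)
  assume "\<not> 0 \<le> D"
  then obtain d where "d > 0" "\<forall>h>0. h < d \<longrightarrow> g (a + h) < g a"
    using DERIV_neg_dec_right[OF assms(1)] by auto
  then have "g (a + d / 2) < g a" by simp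
  then show False using assms(2)[of "a + d / 2"] \<open>d > 0\<close> by simp
qed

text \<open>Both sides of \<open>Re (\<phi> (z0 exp (s \<zeta>))) \<le> exp (s Re \<zeta>)\<close> agree at \<open>s = 0\<close>; compare their derivatives.\<close>
lemma Re_derivative_le_if_norm_le:
  fixes \<phi> :: "complex \<Rightarrow> complex"
  assumes der: "(\<phi> has_field_derivative D) (at z0)" and "z0 \<noteq> 0" "\<phi> z0 = 1"
    and bound: "\<And>z. norm z \<le> norm z0 \<Longrightarrow> norm (\<phi> z) \<le> norm z / norm z0" and "Re \<zeta> \<le> 0"
  shows "Re (z0 * D * \<zeta>) \<le> Re \<zeta>"
proof -
  define g where "g s = exp (s * Re \<zeta>) - Re (\<phi> (z0 * exp (of_real s * \<zeta>)))" for s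
  have "((\<lambda>s::real. z0 * exp (of_real s * \<zeta>)) has_vector_derivative z0 * \<zeta>) (at 0)"
    by (rule has_vector_derivative_real_field) (auto intro!: derivative_eq_intros)
  moreover have "(\<phi> has_field_derivative D) (at (z0 * exp (of_real 0 * \<zeta>)))" using der by simp
  ultimately have "((\<lambda>s::real. \<phi> (z0 * exp (of_real s * \<zeta>))) has_vector_derivative z0 * \<zeta> * D) (at 0)"
    by (rule field_vector_diff_chain_at[unfolded o_def])
  then have "((\<lambda>s. Re (\<phi> (z0 * exp (of_real s * \<zeta>)))) has_real_derivative Re (z0 * \<zeta> * D)) (at 0)"
    unfolding has_real_derivative_iff_has_vector_derivative
    by (rule bounded_linear.has_vector_derivative[OF bounded_linear_Re])
  moreover have "((\<lambda>s. exp (s * Re \<zeta>)) has_real_derivative Re \<zeta>) (at 0)"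
    by (auto intro!: derivative_eq_intros)
  ultimately have "(g has_real_derivative Re \<zeta> - Re (z0 * \<zeta> * D)) (at 0)"
    unfolding g_def[abs_def] by (rule DERIV_diff[rotated])
  then have "0 \<le> Re \<zeta> - Re (z0 * \<zeta> * D)"
  proof (rule deriv_nonneg_if_min_at_right)
    fix s :: real assume "0 < s"
    then have "norm (z0 * exp (of_real s * \<zeta>)) = norm z0 * exp (s * Re \<zeta>)" "exp (s * Re \<zeta>) \<le> 1"
      using \<open>Re \<zeta> \<le> 0\<close> by (simp_all add: norm_mult mult_nonneg_nonpos)
    then have "norm (\<phi> (z0 * exp (of_real s * \<zeta>))) \<le> exp (s * Re \<zeta>)"
      using bound[of "z0 * exp (of_real s * \<zeta>)"] \<open>z0 \<noteq> 0\<close> by (simp add: mult_left_le)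
    then have "Re (\<phi> (z0 * exp (of_real s * \<zeta>))) \<le> exp (s * Re \<zeta>)"
      using complex_Re_le_cmod order_trans by blast
    then show "g 0 \<le> g s" using \<open>\<phi> z0 = 1\<close> by (simp add: g_def)
  qed
  then show ?thesis by (simp only: mult_ac)
qed

lemma Jack_lemma:
  assumes hol: "\<omega> holomorphic_on U" and U: "open U" "cball 0 (norm z0) \<subseteq> U"
    and "\<omega> 0 = 0" "\<omega> z0 \<noteq> 0" and max: "\<And>z. norm z < norm z0 \<Longrightarrow> norm (\<omega> z) \<le> norm (\<omega> z0)"
  obtains k where "k \<ge> 1" "z0 * deriv \<omega> z0 = of_real k * \<omega> z0"
proof -
  have "z0 \<noteq> 0" using \<open>\<omega> 0 = 0\<close> \<open>\<omega> z0 \<noteq> 0\<close> by auto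
  define m where "m = z0 * (deriv \<omega> z0 / \<omega> z0)"
  have direction: "Re (m * \<zeta>) \<le> Re \<zeta>" if "Re \<zeta> \<le> 0" for \<zeta>
    unfolding m_def
  proof (rule Re_derivative_le_if_norm_le[where \<phi> = "\<lambda>z. \<omega> z / \<omega> z0"])
    have "z0 \<in> U" using U(2) by auto
    then show "((\<lambda>z. \<omega> z / \<omega> z0) has_field_derivative deriv \<omega> z0 / \<omega> z0) (at z0)"
      by (intro DERIV_cdivide holomorphic_derivI[OF hol U(1)])
    show "norm (\<omega> z / \<omega> z0) \<le> norm z / norm z0" if "norm z \<le> norm z0" for z
    proof -
      have "norm (\<omega> z) \<le> norm (\<omega> z0) * norm z / norm z0"
        using that max \<open>z0 \<noteq> 0\<close> \<open>\<omega> z0 \<noteq> 0\<close> \<open>\<omega> 0 = 0\<close> U(2) ball_subset_cball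
        by (intro Schwarz_Lemma_cball holomorphic_on_imp_continuous_on holomorphic_on_subset[OF hol]) auto
      then show ?thesis using \<open>\<omega> z0 \<noteq> 0\<close> by (simp add: norm_divide field_simps)
    qed
  qed (use \<open>z0 \<noteq> 0\<close> \<open>\<omega> z0 \<noteq> 0\<close> that in auto)
  have "m = of_real (Re m)" using direction[of \<i>] direction[of "- \<i>"] by (simp add: complex_eq_iff)
  moreover have "Re m \<ge> 1" using direction[of "- 1"] by simp
  moreover have "z0 * deriv \<omega> z0 = m * \<omega> z0" using \<open>\<omega> z0 \<noteq> 0\<close> by (simp add: m_def)
  ultimately show ?thesis using that by metis
qed

lemma norm_less_1_if_no_Jack_point:
  assumes hol: "\<omega> holomorphic_on ball 0 R" and "\<omega> 0 = 0"
    and no_Jack_point: "\<And>z k. \<lbrakk>z \<in> ball 0 R; norm (\<omega> z) = 1; 1 \<le> k; z * deriv \<omega> z = of_real k * \<omega> z\<rbrakk> \<Longrightarrow> False"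
    and z: "z \<in> ball 0 R"
  shows "norm (\<omega> z) < 1"
proof (rule ccontr)
  assume contra: "\<not> norm (\<omega> z) < 1"
  have sub: "cball 0 (norm y) \<subseteq> ball (0::complex) R" if "norm y \<le> norm z" for y :: complex
    using z that by (auto simp: cball_subset_ball_iff)
  have cont: "continuous_on (cball 0 (norm y)) (\<lambda>z. norm (\<omega> z))" if "norm y \<le> norm z" for y :: complex
    by (intro continuous_intros holomorphic_on_imp_continuous_on holomorphic_on_subset[OF hol sub[OF that]])
  define S where "S = cball 0 (norm z) \<inter> (\<lambda>z. norm (\<omega> z)) -` {1..}"
  have "closed S" unfolding S_def by (rule continuous_closed_preimage[OF cont]) auto
  moreover have "bounded S" unfolding S_def by (rule bounded_Int) auto
  moreover have "z \<in> S" using contra by (simp add: S_def)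
  ultimately obtain z0 where z0: "z0 \<in> S" "\<And>y. y \<in> S \<Longrightarrow> norm z0 \<le> norm y"
    using continuous_attains_inf[of S norm] by (auto simp: compact_eq_bounded_closed intro: continuous_intros)
  then have norm_z0_le: "norm z0 \<le> norm z" and ge_1: "norm (\<omega> z0) \<ge> 1" by (auto simp: S_def)
  have less: "norm (\<omega> y) < 1" if "norm y < norm z0" for y
    using z0(2)[of y] that norm_z0_le by (force simp: S_def)
  have "z0 \<noteq> 0" using ge_1 \<open>\<omega> 0 = 0\<close> by auto
  then have "norm (\<omega> z0) \<le> 1"
    using continuous_le_on_closure[of "ball 0 (norm z0)" "\<lambda>z. norm (\<omega> z)" z0 1] cont[OF norm_z0_le] less
    by (auto intro: less_imp_le)
  with ge_1 have unit: "norm (\<omega> z0) = 1" by simp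
  have "\<omega> z0 \<noteq> 0" using unit by auto
  moreover have "norm (\<omega> y) \<le> norm (\<omega> z0)" if "norm y < norm z0" for y using less[OF that] unit by simp
  ultimately obtain k where "1 \<le> k" "z0 * deriv \<omega> z0 = of_real k * \<omega> z0"
    by (rule Jack_lemma[OF hol open_ball sub[OF norm_z0_le] \<open>\<omega> 0 = 0\<close>])
  moreover have "z0 \<in> ball 0 R" using sub[OF norm_z0_le] by auto
  ultimately show False using no_Jack_point unit by blast
qed

lemma Re_divide_one_plus_unit:
  assumes "norm u = 1" "1 + u \<noteq> 0"
  shows "Re (u / (1 + u)) = 1 / 2"
proof -
  have u: "(Re u)\<^sup>2 + (Im u)\<^sup>2 = 1" using assms(1) cmod_power2[of u] by simp
  have "1 + Re u \<noteq> 0"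
  proof
    assume "1 + Re u = 0"
    then have "Re u = - 1" by simp
    with u have "Im u = 0" by simp
    with \<open>Re u = - 1\<close> assms(2) show False by (simp add: complex_eq_iff)
  qed
  moreover have "Re u * (1 + Re u) + Im u * Im u = 1 + Re u" "(1 + Re u)\<^sup>2 + (Im u)\<^sup>2 = 2 * (1 + Re u)"
    using u by (simp_all add: power2_eq_square algebra_simps)
  ultimately show ?thesis by (simp add: Re_divide)
qed

lemma Marx_Strohhaecker:
  assumes hol: "L holomorphic_on ball 0 1" and L0: "L 0 = 0"
    and convex: "\<And>z. z \<in> ball 0 1 \<Longrightarrow> Re (1 + z * deriv L z) > 0" and z: "z \<in> ball 0 1"
  shows "norm (exp (- L z / 2) - 1) < 1"
proof (rule norm_less_1_if_no_Jack_point[where R = 1 and \<omega> = "\<lambda>z. exp (- L z / 2) - 1"])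
  show "(\<lambda>z. exp (- L z / 2) - 1) holomorphic_on ball 0 1" by (intro holomorphic_intros hol) auto
  fix z k assume z: "z \<in> ball 0 1" and unit: "norm (exp (- L z / 2) - 1) = 1" and "1 \<le> k"
    and Jack: "z * deriv (\<lambda>z. exp (- L z / 2) - 1) z = of_real k * (exp (- L z / 2) - 1)"
  define u where "u = exp (- L z / 2) - 1"
  have "1 + u \<noteq> 0" by (simp add: u_def)
  have "((\<lambda>z. exp (- L z / 2) - 1) has_field_derivative - deriv L z / 2 * (1 + u)) (at z)"
    by (auto intro!: derivative_eq_intros holomorphic_derivI[OF hol open_ball z] simp: u_def)
  then have "z * (- deriv L z / 2 * (1 + u)) = of_real k * u"
    using Jack by (simp only: DERIV_imp_deriv u_def)
  then have "z * deriv L z * (1 + u) = - 2 * (of_real k * u)" by (simp add: algebra_simps minus_equation_iff)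
  then have "z * deriv L z = - 2 * (of_real k * u) / (1 + u)"
    using \<open>1 + u \<noteq> 0\<close> by (metis nonzero_eq_divide_eq)
  also have "\<dots> = of_real (- 2 * k) * (u / (1 + u))" by simp
  finally have "Re (z * deriv L z) = - 2 * k * Re (u / (1 + u))"
    by (simp only: Re_complex_of_real Im_complex_of_real times_complex.sel mult_zero_left diff_zero)
  also have "norm u = 1" using unit by (simp add: u_def)
  note Re_divide_one_plus_unit[OF this \<open>1 + u \<noteq> 0\<close>]
  finally show False using convex[OF z] \<open>1 \<le> k\<close> by simp
qed (use z L0 in auto)

lemma abs_Im_log_deriv_less_pi:
  assumes hol: "L holomorphic_on ball 0 1" and L0: "L 0 = 0"
    and convex: "\<And>z. z \<in> ball 0 1 \<Longrightarrow> Re (1 + z * deriv L z) > 0" and z: "z \<in> ball 0 1"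
  shows "\<bar>Im (L z)\<bar> < pi"
proof (rule ccontr)
  assume contra: "\<not> \<bar>Im (L z)\<bar> < pi"
  let ?I = "(\<lambda>z. \<bar>Im (L z)\<bar>) ` ball 0 1"
  have "continuous_on (ball 0 1) (\<lambda>z. \<bar>Im (L z)\<bar>)"
    by (intro continuous_intros holomorphic_on_imp_continuous_on hol)
  then have "connected ?I" by (rule connected_continuous_image) (rule connected_ball)
  moreover have "\<bar>Im (L 0)\<bar> \<in> ?I" "\<bar>Im (L z)\<bar> \<in> ?I" using z by auto
  ultimately have "{\<bar>Im (L 0)\<bar>..\<bar>Im (L z)\<bar>} \<subseteq> ?I" by (rule connected_contains_Icc)
  moreover have "pi \<in> {\<bar>Im (L 0)\<bar>..\<bar>Im (L z)\<bar>}" using contra L0 pi_ge_zero by simp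
  ultimately have "pi \<in> ?I" by (rule subsetD)
  then obtain w where w: "pi = \<bar>Im (L w)\<bar>" "w \<in> ball 0 1" by (rule imageE)
  then have "Im (L w) / 2 = pi / 2 \<or> Im (L w) / 2 = - (pi / 2)" by linarith
  then have "Re (exp (- L w / 2) - 1) = - 1" by (auto simp: Re_exp)
  then have "1 \<le> norm (exp (- L w / 2) - 1)" using abs_Re_le_cmod[of "exp (- L w / 2) - 1"] by simp
  then show False using Marx_Strohhaecker[OF hol L0 convex w(2)] by simp
qed

lemma Apollonius_disc:
  fixes w :: complex
  assumes "norm (w - 1) \<le> r * norm (w + 1)" "0 \<le> r" "r < 1"
  shows "norm (of_real (1 - r\<^sup>2) * w - of_real (1 + r\<^sup>2)) \<le> 2 * r"
proof (rule power2_le_imp_le)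
  define q where "q = r\<^sup>2"
  have "q < 1" using assms by (simp add: q_def abs_square_less_1)
  have "(norm (w - 1))\<^sup>2 \<le> q * (norm (w + 1))\<^sup>2"
    using assms(1) by (metis norm_ge_zero power_mono power_mult_distrib q_def)
  then have "(1 - q) * ((norm w)\<^sup>2 + 1) - 2 * (1 + q) * Re w \<le> 0"
    unfolding cmod_power2 by (simp add: power2_eq_square algebra_simps)
  then have "(1 - q) * ((1 - q) * ((norm w)\<^sup>2 + 1) - 2 * (1 + q) * Re w) \<le> 0"
    using \<open>q < 1\<close> by (simp add: mult_nonneg_nonpos)
  then have "(norm (of_real (1 - q) * w - of_real (1 + q)))\<^sup>2 \<le> 4 * q"
    unfolding cmod_power2 by (simp add: power2_eq_square algebra_simps)
  then show "(norm (of_real (1 - r\<^sup>2) * w - of_real (1 + r\<^sup>2)))\<^sup>2 \<le> (2 * r)\<^sup>2"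
    by (simp add: q_def power_mult_distrib)
qed (use assms in simp)

lemma Re_pos_imp_in_disc:
  assumes hol: "P holomorphic_on ball 0 1" and P0: "P 0 = 1"
    and pos: "\<And>z. z \<in> ball 0 1 \<Longrightarrow> Re (P z) > 0" and z: "norm z < 1"
  shows "norm (of_real (1 - (norm z)\<^sup>2) * P z - of_real (1 + (norm z)\<^sup>2)) \<le> 2 * norm z"
proof (rule Apollonius_disc)
  have nz: "P z + 1 \<noteq> 0" if "z \<in> ball 0 1" for z
    using pos[OF that] by (auto simp: complex_eq_iff)
  have "norm ((P z - 1) / (P z + 1)) \<le> norm z"
  proof (rule Schwarz_Lemma(1)[where f = "\<lambda>z. (P z - 1) / (P z + 1)"])
    show "(\<lambda>z. (P z - 1) / (P z + 1)) holomorphic_on ball 0 1"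
      using nz by (intro holomorphic_intros hol) auto
    show "norm ((P z - 1) / (P z + 1)) < 1" if "norm z < 1" for z
    proof -
      have "(norm (P z - 1))\<^sup>2 < (norm (P z + 1))\<^sup>2"
        using pos[of z] that unfolding cmod_power2 by (simp add: power2_eq_square algebra_simps)
      then show ?thesis using nz[of z] that by (simp add: norm_divide power2_less_imp_less)
    qed
  qed (use P0 z in auto)
  then show "norm (P z - 1) \<le> norm z * norm (P z + 1)"
    using nz[of z] z by (simp add: norm_divide field_simps)
qed (use z in auto)

section \<open>The Hornich operation\<close>

definition classLU :: "(complex \<Rightarrow> complex) \<Rightarrow> bool" where
  "classLU f \<longleftrightarrow> classA f \<and> (\<forall>z\<in>unit_disk. deriv f z \<noteq> 0)"

lemma classLU_D:
  assumes "classLU f"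
  shows "f holomorphic_on unit_disk" "f 0 = 0" "deriv f 0 = 1" "z \<in> unit_disk \<Longrightarrow> deriv f z \<noteq> 0"
  using assms by (auto simp: classLU_def classA_def)

lemma classK_iff_pre_Schwarzian:
  "classK lam f \<longleftrightarrow> classLU f \<and> (\<forall>z\<in>unit_disk. Re (1 + z * pre_Schwarzian f z) > lam)"
  by (auto simp: classK_def classLU_def pre_Schwarzian_def)

lemma eq_on_convex_if_same_derivative:
  fixes f g :: "'a::real_normed_field \<Rightarrow> 'a"
  assumes "convex S" and f: "\<And>z. z \<in> S \<Longrightarrow> (f has_field_derivative h z) (at z within S)"
    and g: "\<And>z. z \<in> S \<Longrightarrow> (g has_field_derivative h z) (at z within S)"
    and "a \<in> S" "f a = g a" "z \<in> S"
  shows "f z = g z"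
proof -
  have "((\<lambda>z. f z - g z) has_field_derivative 0) (at z within S)" if "z \<in> S" for z
    using DERIV_diff[OF f[OF that] g[OF that]] by simp
  then have "\<exists>c. \<forall>z\<in>S. f z - g z = c" by (rule has_field_derivative_zero_constant[OF \<open>convex S\<close>])
  then have "f z - g z = f a - g a" using \<open>a \<in> S\<close> \<open>z \<in> S\<close> by metis
  then show ?thesis using \<open>f a = g a\<close> by simp
qed

lemma deriv_of_logarithm:
  assumes "L holomorphic_on S" "open S" "z \<in> S" and exp_L: "\<And>w. w \<in> S \<Longrightarrow> exp (L w) = g w"
  shows "deriv L z = deriv g z / g z"
proof -
  have "((\<lambda>z. exp (L z)) has_field_derivative exp (L z) * deriv L z) (at z)"
    by (rule DERIV_chain2[OF DERIV_exp holomorphic_derivI[OF assms(1-3)]])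
  then have "(g has_field_derivative exp (L z) * deriv L z) (at z)"
    by (rule has_field_derivative_transform_within_open[OF _ assms(2,3) exp_L])
  then show ?thesis using exp_L[OF \<open>z \<in> S\<close>]
    by (metis DERIV_imp_deriv exp_not_eq_zero nonzero_mult_div_cancel_left)
qed

lemma log_deriv_branch:
  assumes f: "classLU f"
  shows "log_deriv_branch f holomorphic_on unit_disk" "log_deriv_branch f 0 = 0"
    and "z \<in> unit_disk \<Longrightarrow> exp (log_deriv_branch f z) = deriv f z"
proof -
  have "deriv f holomorphic_on unit_disk" by (intro holomorphic_deriv classLU_D(1)[OF f] open_ball)
  then obtain g where g: "g holomorphic_on unit_disk" "\<And>z. z \<in> unit_disk \<Longrightarrow> exp (g z) = deriv f z"
    by (rule holomorphic_logarithm_exists[OF convex_ball open_ball, of "deriv f" 0 1 0])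
      (use classLU_D(4)[OF f] in auto)
  have "exp (g 0) = 1" using g(2)[of 0] classLU_D(3)[OF f] by simp
  then have "\<exists>L. L holomorphic_on unit_disk \<and> L 0 = 0 \<and> (\<forall>z\<in>unit_disk. exp (L z) = deriv f z)"
    using g by (intro exI[of _ "\<lambda>z. g z - g 0"]) (auto simp: exp_diff intro!: holomorphic_intros)
  from someI_ex[OF this] show "log_deriv_branch f holomorphic_on unit_disk" "log_deriv_branch f 0 = 0"
    "z \<in> unit_disk \<Longrightarrow> exp (log_deriv_branch f z) = deriv f z"
    by (auto simp: log_deriv_branch_def)
qed

lemma deriv_log_deriv_branch:
  "classLU f \<Longrightarrow> z \<in> unit_disk \<Longrightarrow> deriv (log_deriv_branch f) z = pre_Schwarzian f z"
  unfolding pre_Schwarzian_def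
  by (rule deriv_of_logarithm[OF log_deriv_branch(1) open_ball _ log_deriv_branch(3)])

lemma log_deriv_branch_unique:
  assumes f: "classLU f" and L: "L holomorphic_on unit_disk" "L 0 = 0"
    "\<And>z. z \<in> unit_disk \<Longrightarrow> exp (L z) = deriv f z" and z: "z \<in> unit_disk"
  shows "log_deriv_branch f z = L z"
proof (rule eq_on_convex_if_same_derivative[where S = unit_disk and a = 0
      and f = "log_deriv_branch f" and g = L])
  fix w assume w: "w \<in> unit_disk"
  show "(L has_field_derivative pre_Schwarzian f w) (at w within unit_disk)"
    using holomorphic_derivI[OF L(1) open_ball w] deriv_of_logarithm[OF L(1) open_ball w L(3)]
    by (simp add: pre_Schwarzian_def)
  show "(log_deriv_branch f has_field_derivative pre_Schwarzian f w) (at w within unit_disk)"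
    using holomorphic_derivI[OF log_deriv_branch(1)[OF f] open_ball w] deriv_log_deriv_branch[OF f w] by simp
qed (use z L(2) log_deriv_branch(2)[OF f] in auto)

lemma hornich_has_field_derivative:
  assumes f: "classLU f" and z: "z \<in> unit_disk"
  shows "(hornich \<gamma> f has_field_derivative exp (\<gamma> * log_deriv_branch f z)) (at z)"
proof -
  let ?h = "\<lambda>w. exp (\<gamma> * log_deriv_branch f w)"
  have "?h holomorphic_on unit_disk" by (intro holomorphic_intros log_deriv_branch(1)[OF f])
  then obtain g where g: "\<And>w. w \<in> unit_disk \<Longrightarrow> (g has_field_derivative ?h w) (at w within unit_disk)"
    using holomorphic_convex_primitive'[OF convex_ball open_ball] by blast
  have eq: "g w - g 0 = hornich \<gamma> f w" if w: "w \<in> unit_disk" for w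
  proof -
    have "path_image (linepath 0 w) \<subseteq> unit_disk"
      using w by (simp add: closed_segment_subset)
    from contour_integral_primitive[OF g valid_path_linepath this]
    have "(?h has_contour_integral g w - g 0) (linepath 0 w)" by simp
    then show ?thesis by (simp add: hornich_def contour_integral_unique)
  qed
  have "((\<lambda>w. g w - g 0) has_field_derivative ?h z) (at z)"
    using g[OF z] z by (auto intro!: derivative_eq_intros simp: at_within_open[OF z open_ball])
  then show ?thesis
    by (rule has_field_derivative_transform_within_open[OF _ open_ball z eq])
qed

lemma hornich_0 [simp]: "hornich \<gamma> f 0 = 0"
  by (simp add: hornich_def)

lemma deriv_hornich:
  "classLU f \<Longrightarrow> z \<in> unit_disk \<Longrightarrow> deriv (hornich \<gamma> f) z = exp (\<gamma> * log_deriv_branch f z)"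
  by (intro DERIV_imp_deriv hornich_has_field_derivative)

lemma hornich_unique:
  assumes f: "classLU f" and "G 0 = 0" "z \<in> unit_disk"
    and G: "\<And>z. z \<in> unit_disk \<Longrightarrow> (G has_field_derivative exp (\<gamma> * log_deriv_branch f z)) (at z)"
  shows "hornich \<gamma> f z = G z"
proof (rule eq_on_convex_if_same_derivative[where S = unit_disk and a = 0
      and f = "hornich \<gamma> f" and g = G])
  fix w assume w: "w \<in> unit_disk"
  show "(hornich \<gamma> f has_field_derivative exp (\<gamma> * log_deriv_branch f w)) (at w within unit_disk)"
    using hornich_has_field_derivative[OF f w] by (rule has_field_derivative_at_within)
  show "(G has_field_derivative exp (\<gamma> * log_deriv_branch f w)) (at w within unit_disk)"
    using G[OF w] by (rule has_field_derivative_at_within)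
qed (use assms in auto)

lemma classLU_hornich:
  assumes f: "classLU f"
  shows "classLU (hornich \<gamma> f)"
proof -
  have "hornich \<gamma> f holomorphic_on unit_disk"
    unfolding holomorphic_on_open[OF open_ball] using hornich_has_field_derivative[OF f] by blast
  then show ?thesis by (simp add: classLU_def classA_def deriv_hornich[OF f] log_deriv_branch(2)[OF f])
qed

lemma classS_hornich_iff:
  "classLU f \<Longrightarrow> classS (hornich \<gamma> f) \<longleftrightarrow> inj_on (hornich \<gamma> f) unit_disk"
  using classLU_hornich by (auto simp: classS_def classLU_def)

lemma log_deriv_branch_hornich:
  assumes f: "classLU f" and z: "z \<in> unit_disk"
  shows "log_deriv_branch (hornich \<gamma> f) z = \<gamma> * log_deriv_branch f z"
  by (rule log_deriv_branch_unique[OF classLU_hornich[OF f] _ _ _ z])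
    (auto simp: log_deriv_branch(2)[OF f] deriv_hornich[OF f]
      intro!: holomorphic_intros log_deriv_branch(1)[OF f])

lemma pre_Schwarzian_hornich:
  assumes f: "classLU f" and z: "z \<in> unit_disk"
  shows "pre_Schwarzian (hornich \<gamma> f) z = \<gamma> * pre_Schwarzian f z"
proof -
  have "((\<lambda>z. \<gamma> * log_deriv_branch f z) has_field_derivative \<gamma> * pre_Schwarzian f z) (at z)"
    using holomorphic_derivI[OF log_deriv_branch(1)[OF f] open_ball z] deriv_log_deriv_branch[OF f z]
    by (intro DERIV_cmult) simp
  then have "(log_deriv_branch (hornich \<gamma> f) has_field_derivative \<gamma> * pre_Schwarzian f z) (at z)"
    by (rule has_field_derivative_transform_within_open[OF _ open_ball z])
      (simp add: log_deriv_branch_hornich[OF f])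
  then show ?thesis using deriv_log_deriv_branch[OF classLU_hornich[OF f, of \<gamma>] z]
    by (simp add: DERIV_imp_deriv)
qed

lemma hornich_hornich:
  assumes f: "classLU f" and z: "z \<in> unit_disk"
  shows "hornich \<alpha> (hornich \<beta> f) z = hornich (\<alpha> * \<beta>) f z"
  using hornich_has_field_derivative[OF f, of _ "\<alpha> * \<beta>"]
  by (intro hornich_unique[OF classLU_hornich[OF f] _ z])
    (auto simp: log_deriv_branch_hornich[OF f] mult.assoc)

lemma classS_hornich_hornich_iff:
  assumes f: "classLU f"
  shows "classS (hornich \<alpha> (hornich \<beta> f)) \<longleftrightarrow> classS (hornich (\<alpha> * \<beta>) f)"
  unfolding classS_hornich_iff[OF f] classS_hornich_iff[OF classLU_hornich[OF f]]
  by (rule inj_on_cong) (rule hornich_hornich[OF f])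

lemma classK_hornich:
  assumes "classK lam f" "0 < t"
  shows "classK (1 - t * (1 - lam)) (hornich (of_real t) f)"
proof -
  have f: "classLU f" and K: "\<And>z. z \<in> unit_disk \<Longrightarrow> Re (1 + z * pre_Schwarzian f z) > lam"
    using assms(1) by (auto simp: classK_iff_pre_Schwarzian)
  have "1 - t * (1 - lam) < Re (1 + z * pre_Schwarzian (hornich (of_real t) f) z)" if z: "z \<in> unit_disk" for z
  proof -
    have "1 + z * pre_Schwarzian (hornich (of_real t) f) z = 1 + t *\<^sub>R (z * pre_Schwarzian f z)"
      by (simp add: pre_Schwarzian_hornich[OF f z] scaleR_conv_of_real mult_ac)
    then have "Re (1 + z * pre_Schwarzian (hornich (of_real t) f) z) = 1 + t * Re (z * pre_Schwarzian f z)"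
      by (simp only: plus_complex.sel one_complex.sel scaleR_complex.sel)
    moreover have "t * (lam - 1) < t * Re (z * pre_Schwarzian f z)"
      using K[OF z] \<open>0 < t\<close> by (intro mult_strict_left_mono) auto
    ultimately show ?thesis by (simp add: algebra_simps)
  qed
  then show ?thesis using classLU_hornich[OF f] by (simp add: classK_iff_pre_Schwarzian)
qed

lemma classK_antimono: "classK lam f \<Longrightarrow> lam' \<le> lam \<Longrightarrow> classK lam' f"
  by (auto simp: classK_def)

definition univalence_set :: "real \<Rightarrow> complex set" where
  "univalence_set lam = {\<gamma>. \<forall>f. classK lam f \<longrightarrow> classS (hornich \<gamma> f)}"

lemma divide_in_univalence_set:
  assumes "0 < t" and \<gamma>: "\<gamma> \<in> univalence_set lam"
  shows "\<gamma> / of_real t \<in> univalence_set (1 - t * (1 - lam))"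
  unfolding univalence_set_def
proof (intro CollectI allI impI)
  fix f assume "classK (1 - t * (1 - lam)) f"
  from classK_hornich[OF this, of "1 / t"] have "classK lam (hornich (of_real (1 / t)) f)"
    using \<open>0 < t\<close> by simp
  then have "classS (hornich \<gamma> (hornich (of_real (1 / t)) f))" using \<gamma> by (simp add: univalence_set_def)
  moreover have "classLU f" using \<open>classK _ f\<close> by (simp add: classK_iff_pre_Schwarzian)
  ultimately show "classS (hornich (\<gamma> / of_real t) f)" by (simp add: classS_hornich_hornich_iff)
qed

lemma univalence_set_scaling:
  assumes "lam < 1"
  shows "\<gamma> \<in> univalence_set lam \<longleftrightarrow> of_real (1 - lam) * \<gamma> \<in> univalence_set 0"
  using divide_in_univalence_set[of "1 / (1 - lam)" \<gamma> lam]
    divide_in_univalence_set[of "1 - lam" "of_real (1 - lam) * \<gamma>" 0] assms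
  by (auto simp: mult.commute)

section \<open>Univalent transforms of convex functions\<close>

lemma inj_on_hornich_small:
  assumes K: "classK 0 f" and \<gamma>: "norm \<gamma> \<le> 1 / 2" "\<gamma> \<noteq> 1 / 2"
  shows "inj_on (hornich \<gamma> f) unit_disk"
proof (rule Ahlfors_univalence_criterion)
  have f: "classLU f" and convex: "\<And>z. z \<in> unit_disk \<Longrightarrow> Re (1 + z * pre_Schwarzian f z) > 0"
    using K by (auto simp: classK_iff_pre_Schwarzian)
  note F = classLU_D[OF classLU_hornich[OF f]]
  show "hornich \<gamma> f holomorphic_on unit_disk" "\<And>z. z \<in> unit_disk \<Longrightarrow> deriv (hornich \<gamma> f) z \<noteq> 0"
    using F by auto
  show "norm (- 2 * \<gamma>) \<le> 1" "- 2 * \<gamma> \<noteq> - 1" using \<gamma> by (auto simp: norm_mult field_simps)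
  fix z :: complex assume z: "z \<in> unit_disk"
  define P where "P z = 1 + z * pre_Schwarzian f z" for z
  have "P holomorphic_on unit_disk"
    unfolding P_def[abs_def] pre_Schwarzian_def using classLU_D(1,4)[OF f]
    by (auto intro!: holomorphic_intros holomorphic_deriv)
  then have "norm (of_real (1 - (norm z)\<^sup>2) * P z - of_real (1 + (norm z)\<^sup>2)) \<le> 2 * norm z"
    by (rule Re_pos_imp_in_disc) (use convex z in \<open>auto simp: P_def\<close>)
  then have "norm (\<gamma> * (of_real (1 - (norm z)\<^sup>2) * P z - of_real (1 + (norm z)\<^sup>2))) \<le> 1 / 2 * (2 * norm z)"
    unfolding norm_mult using \<gamma>(1) by (intro mult_mono) auto
  also have "\<dots> < 1" using z by simp
  also have "\<gamma> * (of_real (1 - (norm z)\<^sup>2) * P z - of_real (1 + (norm z)\<^sup>2)) =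
      - 2 * \<gamma> * of_real ((norm z)\<^sup>2) + of_real (1 - (norm z)\<^sup>2) * (z * pre_Schwarzian (hornich \<gamma> f) z)"
    by (simp add: pre_Schwarzian_hornich[OF f z] P_def algebra_simps)
  finally show "norm (- 2 * \<gamma> * of_real ((norm z)\<^sup>2) +
      of_real (1 - (norm z)\<^sup>2) * (z * pre_Schwarzian (hornich \<gamma> f) z)) < 1" .
qed

lemma inj_on_hornich_segment:
  assumes K: "classK 0 f" and t: "1 / 2 \<le> t" "t \<le> 3 / 2"
  shows "inj_on (hornich (of_real t) f) unit_disk"
proof (rule close_to_convex_imp_inj_on[where f = f])
  have f: "classLU f" and convex: "\<And>z. z \<in> unit_disk \<Longrightarrow> Re (1 + z * pre_Schwarzian f z) > 0"
    using K by (auto simp: classK_iff_pre_Schwarzian)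
  show "f holomorphic_on unit_disk" "hornich (of_real t) f holomorphic_on unit_disk"
    "\<And>z. z \<in> unit_disk \<Longrightarrow> deriv f z \<noteq> 0"
    using classLU_D[OF f] classLU_D[OF classLU_hornich[OF f]] by auto
  show "Re (1 + z * pre_Schwarzian f z) > 0" if "z \<in> unit_disk" for z using that by (rule convex)
  fix z :: complex assume z: "z \<in> unit_disk"
  let ?L = "log_deriv_branch f"
  have "\<bar>Im (?L z)\<bar> < pi"
    using log_deriv_branch(1,2)[OF f] z convex
    by (intro abs_Im_log_deriv_less_pi) (auto simp: deriv_log_deriv_branch[OF f])
  moreover have "\<bar>(t - 1) * Im (?L z)\<bar> \<le> 1 / 2 * \<bar>Im (?L z)\<bar>"
    unfolding abs_mult using t by (intro mult_right_mono abs_leI) auto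
  ultimately have "cos ((t - 1) * Im (?L z)) > 0" by (intro cos_gt_zero_pi) linarith+
  moreover have "deriv (hornich (of_real t) f) z / deriv f z = exp (of_real (t - 1) * ?L z)"
    by (simp add: deriv_hornich[OF f z] exp_diff algebra_simps flip: log_deriv_branch(3)[OF f z])
  ultimately show "Re (deriv (hornich (of_real t) f) z / deriv f z) > 0"
    by (simp add: Re_exp)
qed

section \<open>The extremal function\<close>

lemma one_minus_exp_in_unit_disk:
  assumes "exp (Re p) < 2 * cos (Im p)"
  shows "1 - exp p \<in> unit_disk"
proof -
  have "(norm (1 - exp p))\<^sup>2 = 1 - 2 * (exp (Re p) * cos (Im p)) +
      (exp (Re p))\<^sup>2 * ((cos (Im p))\<^sup>2 + (sin (Im p))\<^sup>2)"
    unfolding cmod_power2 minus_complex.sel one_complex.sel Re_exp Im_exp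
    by (simp only: power2_eq_square) algebra
  also have "\<dots> = 1 - exp (Re p) * (2 * cos (Im p) - exp (Re p))"
    unfolding sin_cos_squared_add2 by (simp add: power2_eq_square algebra_simps)
  also have "\<dots> < 1\<^sup>2" using assms by simp
  finally have "norm (1 - exp p) < 1" by (rule power2_less_imp_less) simp
  then show ?thesis by simp
qed

lemma Ln_one_minus_differ_by:
  assumes "\<bar>Im v\<bar> < pi"
  obtains z w where "z \<in> unit_disk" "w \<in> unit_disk" "Ln (1 - z) = Ln (1 - w) + v"
proof -
  define C where "C = cos (Im v / 2)"
  have "C > 0" unfolding C_def using assms by (intro cos_gt_zero_pi) auto
  define q where "q = of_real (ln C - \<bar>Re v\<bar> / 2) - v / 2"
  have disk: "1 - exp p \<in> unit_disk" "Ln (exp p) = p" if "p = q \<or> p = q + v" for p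
  proof -
    have Im_p: "Im p = Im v / 2 \<or> Im p = - (Im v / 2)" and "Re p \<le> ln C" using that by (auto simp: q_def)
    then have "exp (Re p) \<le> C" using \<open>C > 0\<close> by (metis exp_le_cancel_iff exp_ln)
    also have "cos (Im p) = C" using Im_p by (metis C_def cos_minus)
    then have "C < 2 * cos (Im p)" using \<open>C > 0\<close> by simp
    finally show "1 - exp p \<in> unit_disk" by (rule one_minus_exp_in_unit_disk)
    show "Ln (exp p) = p" using Im_p assms by (intro Ln_exp) auto
  qed
  show ?thesis using that[of "1 - exp (q + v)" "1 - exp q"] disk by simp
qed

lemma abs_Re_inverse_less_half:
  fixes a :: complex
  assumes "norm (a - 1) > 1" "norm (a + 1) > 1"
  shows "\<bar>Re (1 / a)\<bar> < 1 / 2"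
proof -
  have "a \<noteq> 0" using assms by auto
  have "(norm (a - 1))\<^sup>2 > 1" "(norm (a + 1))\<^sup>2 > 1" using assms by (simp_all add: one_less_power)
  then have "\<bar>2 * Re a\<bar> < (norm a)\<^sup>2"
    unfolding cmod_power2 by (simp add: abs_less_iff power2_eq_square algebra_simps)
  then have "\<bar>Re a\<bar> / (norm a)\<^sup>2 < 1 / 2" using \<open>a \<noteq> 0\<close> by (simp add: field_simps)
  moreover have "\<bar>Re (1 / a)\<bar> = \<bar>Re a\<bar> / (norm a)\<^sup>2" by (simp add: Re_divide cmod_power2)
  ultimately show ?thesis by (simp only:)
qed

text \<open>Shifting \<open>Ln (1 - z)\<close> by \<open>2 \<pi> \<i> / a\<close> does not change the power.\<close>
lemma not_inj_on_one_minus_powr: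
  fixes a :: complex
  assumes "norm (a - 1) > 1" "norm (a + 1) > 1"
  shows "\<not> inj_on (\<lambda>z. (1 - z) powr a) unit_disk"
proof
  assume inj: "inj_on (\<lambda>z. (1 - z) powr a) unit_disk"
  have "a \<noteq> 0" using assms by auto
  define v where "v = of_real (2 * pi) * (\<i> / a)"
  have "Im v = 2 * pi * Re (1 / a)" by (simp add: v_def Re_divide Im_divide)
  then have "\<bar>Im v\<bar> < pi" using abs_Re_inverse_less_half[OF assms] by (simp add: abs_mult)
  then obtain z w where zw: "z \<in> unit_disk" "w \<in> unit_disk" "Ln (1 - z) = Ln (1 - w) + v"
    by (rule Ln_one_minus_differ_by)
  then have "1 - z \<noteq> 0" "1 - w \<noteq> 0" by auto
  have "a * Ln (1 - z) = a * Ln (1 - w) + 2 * of_real pi * \<i>"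
    using zw(3) \<open>a \<noteq> 0\<close> by (simp add: v_def algebra_simps)
  then have "exp (a * Ln (1 - z)) = exp (a * Ln (1 - w))" by (simp add: exp_add)
  then have "(1 - z) powr a = (1 - w) powr a" using \<open>1 - z \<noteq> 0\<close> \<open>1 - w \<noteq> 0\<close> by (simp add: powr_def)
  then have "z = w" using inj_onD[OF inj _ zw(1,2)] by blast
  then show False using zw(3) \<open>a \<noteq> 0\<close> by (simp add: v_def)
qed

definition half_plane_map :: "complex \<Rightarrow> complex" where
  "half_plane_map z = z / (1 - z)"

lemma one_minus_in_slit_plane: "z \<in> unit_disk \<Longrightarrow> 1 - z \<noteq> 0 \<and> 1 - z \<notin> \<real>\<^sub>\<le>\<^sub>0"
  using complex_Re_le_cmod[of z] by (auto simp: complex_nonpos_Reals_iff)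

lemma half_plane_map_has_field_derivative:
  assumes "z \<in> unit_disk"
  shows "(half_plane_map has_field_derivative 1 / (1 - z)\<^sup>2) (at z)"
  unfolding half_plane_map_def[abs_def] using one_minus_in_slit_plane[OF assms]
  by (auto intro!: derivative_eq_intros simp: power2_eq_square divide_simps)

lemma deriv_half_plane_map: "z \<in> unit_disk \<Longrightarrow> deriv half_plane_map z = 1 / (1 - z)\<^sup>2"
  by (rule DERIV_imp_deriv[OF half_plane_map_has_field_derivative])

lemma pre_Schwarzian_half_plane_map:
  assumes "z \<in> unit_disk"
  shows "pre_Schwarzian half_plane_map z = 2 / (1 - z)"
proof -
  have "((\<lambda>z. 1 / (1 - z)\<^sup>2) has_field_derivative 2 / (1 - z) ^ 3) (at z)"
    using one_minus_in_slit_plane[OF assms]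
    by (auto intro!: derivative_eq_intros simp: power2_eq_square power3_eq_cube divide_simps)
  then have "(deriv half_plane_map has_field_derivative 2 / (1 - z) ^ 3) (at z)"
    by (rule has_field_derivative_transform_within_open[OF _ open_ball assms])
      (simp add: deriv_half_plane_map)
  then show ?thesis
    using one_minus_in_slit_plane[OF assms] deriv_half_plane_map[OF assms]
    by (simp add: pre_Schwarzian_def DERIV_imp_deriv power2_eq_square power3_eq_cube)
qed

lemma classLU_half_plane_map: "classLU half_plane_map"
proof -
  have "half_plane_map holomorphic_on unit_disk"
    unfolding holomorphic_on_open[OF open_ball] using half_plane_map_has_field_derivative by blast
  then show ?thesis
    using one_minus_in_slit_plane
    by (auto simp: classLU_def classA_def deriv_half_plane_map) (simp add: half_plane_map_def)
qed

lemma classK_half_plane_map: "classK 0 half_plane_map"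
proof -
  have "0 < Re (1 + z * pre_Schwarzian half_plane_map z)" if z: "z \<in> unit_disk" for z
  proof -
    have nz: "1 - z \<noteq> 0" using one_minus_in_slit_plane[OF z] by simp
    have "1 + z * pre_Schwarzian half_plane_map z = 2 / (1 + - z) - 1"
      unfolding pre_Schwarzian_half_plane_map[OF z] using nz by (simp add: field_simps)
    moreover have "0 < Re (2 / (1 + - z) - 1)" using Re_two_divide_one_plus_gt_1[of "- z"] z by simp
    ultimately show ?thesis by (simp only:)
  qed
  then show ?thesis using classLU_half_plane_map by (simp add: classK_iff_pre_Schwarzian)
qed

lemma log_deriv_branch_half_plane_map:
  assumes "z \<in> unit_disk"
  shows "log_deriv_branch half_plane_map z = - 2 * Ln (1 - z)"
proof (rule log_deriv_branch_unique[OF classLU_half_plane_map _ _ _ assms])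
  show "(\<lambda>z. - 2 * Ln (1 - z)) holomorphic_on unit_disk"
    using one_minus_in_slit_plane by (intro holomorphic_intros) auto
  fix z :: complex assume z: "z \<in> unit_disk"
  have "exp (- 2 * Ln (1 - z)) = 1 / (exp (Ln (1 - z)))\<^sup>2"
    by (simp add: exp_minus exp_double inverse_eq_divide)
  then show "exp (- 2 * Ln (1 - z)) = deriv half_plane_map z"
    using one_minus_in_slit_plane[OF z] deriv_half_plane_map[OF z] by simp
qed simp

lemma hornich_half_plane_map:
  assumes "2 * \<gamma> \<noteq> 1" and z: "z \<in> unit_disk"
  shows "hornich \<gamma> half_plane_map z = (1 - (1 - z) powr (1 - 2 * \<gamma>)) / (1 - 2 * \<gamma>)"
proof (rule hornich_unique[OF classLU_half_plane_map _ z])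
  fix z assume z: "z \<in> unit_disk"
  have a: "1 - 2 * \<gamma> \<noteq> 0" using assms(1) by simp
  have "((\<lambda>z. (1 - (1 - z) powr (1 - 2 * \<gamma>)) / (1 - 2 * \<gamma>)) has_field_derivative
      (1 - z) powr (- 2 * \<gamma>)) (at z)"
    using one_minus_in_slit_plane[OF z] a by (auto intro!: derivative_eq_intros)
  also have "(1 - z) powr (- 2 * \<gamma>) = exp (\<gamma> * log_deriv_branch half_plane_map z)"
    using one_minus_in_slit_plane[OF z] by (simp add: powr_def log_deriv_branch_half_plane_map[OF z] mult_ac)
  finally show "((\<lambda>z. (1 - (1 - z) powr (1 - 2 * \<gamma>)) / (1 - 2 * \<gamma>)) has_field_derivative
      exp (\<gamma> * log_deriv_branch half_plane_map z)) (at z)" .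
qed simp

lemma not_inj_on_hornich_half_plane_map:
  assumes "norm (2 * \<gamma>) > 1" "norm (2 * \<gamma> - 2) > 1"
  shows "\<not> inj_on (hornich \<gamma> half_plane_map) unit_disk"
proof
  assume inj: "inj_on (hornich \<gamma> half_plane_map) unit_disk"
  have "2 * \<gamma> \<noteq> 1" using assms(1) by (metis less_irrefl norm_one)
  have "inj_on (\<lambda>z. (1 - z) powr (1 - 2 * \<gamma>)) unit_disk"
    using inj by (auto simp: inj_on_def hornich_half_plane_map[OF \<open>2 * \<gamma> \<noteq> 1\<close>])
  moreover have "norm ((1 - 2 * \<gamma>) - 1) > 1" "norm ((1 - 2 * \<gamma>) + 1) > 1"
    using assms norm_minus_commute[of "2 * \<gamma>" 2] by simp_all
  ultimately show False using not_inj_on_one_minus_powr by blast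
qed

lemma norm_diff_2_gt_1_if_unit:
  fixes u :: complex
  assumes "norm u = 1" "u \<noteq> 1"
  shows "norm (u - 2) > 1"
proof -
  have u: "(Re u)\<^sup>2 + (Im u)\<^sup>2 = 1" using assms(1) cmod_power2[of u] by simp
  have "Re u \<noteq> 1" using u assms(2) by (auto simp: complex_eq_iff)
  moreover have "Re u \<le> 1" using complex_Re_le_cmod[of u] assms(1) by simp
  ultimately have "(norm (u - 2))\<^sup>2 > 1\<^sup>2"
    using u unfolding cmod_power2 by (simp add: power2_eq_square algebra_simps)
  then show ?thesis by (rule power2_less_imp_less) simp
qed

lemma shrink_outside_discs:
  fixes c :: complex
  assumes "norm c > 1" "c \<notin> of_real ` {1..3}"
  obtains t where "0 < t" "t \<le> 1" "norm (of_real t * c) > 1" "norm (of_real t * c - 2) > 1"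
proof (cases "sgn c = 1")
  case True
  then have c: "c = of_real (norm c)" using assms(1) by (auto simp: sgn_eq field_simps)
  then have "norm c > 3" using assms by (metis atLeastAtMost_iff image_eqI less_imp_le not_le)
  then have "norm (of_real (norm c - 2) :: complex) > 1" unfolding norm_of_real by simp
  then have "norm (c - 2) > 1" using c by simp
  then show ?thesis using that[of 1] assms(1) by simp
next
  case False
  let ?s = "1 / norm c"
  have "((\<lambda>t. norm (of_real t * c - 2)) \<longlongrightarrow> norm (of_real ?s * c - 2)) (at_right ?s)"
    by (intro tendsto_intros)
  moreover have "norm (sgn c) = 1" using assms(1) by (auto simp: norm_sgn)
  then have "norm (of_real ?s * c - 2) > 1" using norm_diff_2_gt_1_if_unit[OF _ False] by (simp add: sgn_eq)
  ultimately have "\<forall>\<^sub>F t in at_right ?s. norm (of_real t * c - 2) > 1" by (rule order_tendstoD)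
  moreover have "\<forall>\<^sub>F t in at_right ?s. t \<in> {?s<..<1}"
    by (rule eventually_at_right_real) (use assms(1) in \<open>simp add: divide_less_eq\<close>)
  ultimately have "\<forall>\<^sub>F t in at_right ?s. t \<in> {?s<..<1} \<and> norm (of_real t * c - 2) > 1" by eventually_elim simp
  then obtain t where t: "?s < t" "t < 1" "norm (of_real t * c - 2) > 1"
    using eventually_happens'[OF trivial_limit_at_right_real] by auto
  have "0 < t" using t(1) by (rule le_less_trans[rotated]) simp
  moreover have "0 < norm c" using assms(1) by linarith
  then have "norm (of_real t * c) > 1" using t(1) \<open>0 < t\<close> by (simp add: norm_mult pos_divide_less_eq)
  ultimately show ?thesis using that t by simp
qed

section \<open>The univalence set\<close>

lemma of_real_mult_in_of_real_Icc_iff: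
  fixes z :: "'a::real_field"
  assumes "0 < m"
  shows "of_real m * z \<in> of_real ` {a..b} \<longleftrightarrow> z \<in> of_real ` {a / m..b / m}"
proof
  assume "of_real m * z \<in> of_real ` {a..b}"
  then obtain x where "x \<in> {a..b}" "of_real m * z = of_real x" by blast
  then have "z = of_real (x / m)" "x / m \<in> {a / m..b / m}"
    using assms by (auto simp: field_simps divide_right_mono)
  then show "z \<in> of_real ` {a / m..b / m}" by blast
next
  assume "z \<in> of_real ` {a / m..b / m}"
  then obtain x where "x \<in> {a / m..b / m}" "z = of_real x" by blast
  then have "of_real m * z = of_real (m * x)" "m * x \<in> {a..b}"
    using assms by (auto simp: field_simps)
  then show "of_real m * z \<in> of_real ` {a..b}" by blast
qed

lemma univalence_set_0_subset: "univalence_set 0 \<subseteq> {\<gamma>. norm \<gamma> \<le> 1 / 2} \<union> of_real ` {1 / 2..3 / 2}"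
proof (rule subsetI, rule ccontr)
  fix \<gamma> assume \<gamma>: "\<gamma> \<in> univalence_set 0" and out: "\<gamma> \<notin> {\<gamma>. norm \<gamma> \<le> 1 / 2} \<union> of_real ` {1 / 2..3 / 2}"
  have "2 * \<gamma> \<notin> of_real ` {1..3}"
    using of_real_mult_in_of_real_Icc_iff[of 2 \<gamma> 1 3] out by simp
  moreover have "norm (2 * \<gamma>) > 1" using out by (simp add: norm_mult)
  ultimately obtain t where t: "0 < t" "t \<le> 1"
    and big: "norm (of_real t * (2 * \<gamma>)) > 1" "norm (of_real t * (2 * \<gamma>) - 2) > 1"
    using shrink_outside_discs by blast
  let ?f = "hornich (of_real t) half_plane_map"
  have "classK 0 ?f"
    using classK_hornich[OF classK_half_plane_map t(1)] t(2) by (auto intro: classK_antimono)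
  then have "classS (hornich \<gamma> ?f)" using \<gamma> by (simp add: univalence_set_def)
  then have "inj_on (hornich (\<gamma> * of_real t) half_plane_map) unit_disk"
    by (simp only: classS_hornich_hornich_iff classS_hornich_iff classLU_half_plane_map)
  then show False using not_inj_on_hornich_half_plane_map[of "\<gamma> * of_real t"] big by (simp add: mult_ac)
qed

lemma subset_univalence_set_0: "{\<gamma>. norm \<gamma> \<le> 1 / 2} \<union> of_real ` {1 / 2..3 / 2} \<subseteq> univalence_set 0"
proof
  fix \<gamma> :: complex assume \<gamma>: "\<gamma> \<in> {\<gamma>. norm \<gamma> \<le> 1 / 2} \<union> of_real ` {1 / 2..3 / 2}"
  have "inj_on (hornich \<gamma> f) unit_disk" if K: "classK 0 f" for f
  proof (cases "\<gamma> \<in> of_real ` {1 / 2..3 / 2}")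
    case True
    then show ?thesis using inj_on_hornich_segment[OF K] by auto
  next
    case False
    moreover have "complex_of_real (1 / 2) \<in> of_real ` {1 / 2..3 / 2}" by (intro imageI) simp
    ultimately have "norm \<gamma> \<le> 1 / 2" "\<gamma> \<noteq> of_real (1 / 2)" using \<gamma> by blast+
    then show ?thesis using inj_on_hornich_small[OF K] by simp
  qed
  then show "\<gamma> \<in> univalence_set 0"
    using classS_hornich_iff by (auto simp: univalence_set_def classK_iff_pre_Schwarzian)
qed

lemma univalence_set_0: "univalence_set 0 = {\<gamma>. norm \<gamma> \<le> 1 / 2} \<union> of_real ` {1 / 2..3 / 2}"
  using univalence_set_0_subset subset_univalence_set_0 by (rule equalityI)

theorem theorem2p1:
  fixes lam :: real
  assumes "lam < 1"
  shows "{\<gamma>::complex. \<forall>f. classK lam f \<longrightarrow> classS (hornich \<gamma> f)} =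
         {\<gamma>. cmod \<gamma> \<le> 1 / (2 * (1 - lam))} \<union>
         complex_of_real ` {1 / (2 * (1 - lam)) .. 3 / (2 * (1 - lam))}"
proof (rule set_eqI)
  fix \<gamma> :: complex
  have "0 < 1 - lam" using assms by simp
  have "\<gamma> \<in> univalence_set lam \<longleftrightarrow>
      norm (of_real (1 - lam) * \<gamma>) \<le> 1 / 2 \<or> of_real (1 - lam) * \<gamma> \<in> of_real ` {1 / 2..3 / 2}"
    unfolding univalence_set_scaling[OF assms] univalence_set_0 by simp
  also have "norm (of_real (1 - lam) * \<gamma>) \<le> 1 / 2 \<longleftrightarrow> norm \<gamma> \<le> 1 / (2 * (1 - lam))"
    unfolding norm_mult norm_of_real using \<open>0 < 1 - lam\<close> by (simp add: field_simps)
  also have "of_real (1 - lam) * \<gamma> \<in> of_real ` {1 / 2..3 / 2} \<longleftrightarrow>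
      \<gamma> \<in> of_real ` {1 / (2 * (1 - lam))..3 / (2 * (1 - lam))}"
    unfolding of_real_mult_in_of_real_Icc_iff[OF \<open>0 < 1 - lam\<close>] by simp
  finally show "\<gamma> \<in> {\<gamma>::complex. \<forall>f. classK lam f \<longrightarrow> classS (hornich \<gamma> f)} \<longleftrightarrow>
      \<gamma> \<in> {\<gamma>. cmod \<gamma> \<le> 1 / (2 * (1 - lam))} \<union>
         complex_of_real ` {1 / (2 * (1 - lam)) .. 3 / (2 * (1 - lam))}"
    by (simp add: univalence_set_def)
qed

end
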